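(* Let $(X,\|\cdot\|_X)$ be a complex Banach space and $p\in[1,\infty]$. Suppose that there exist some $\eta\in(0,1)$ and $d\in\mathbb{N}$ such that for every $n\in\mathbb{N}$ with $d\in\{1,\ldots,n\}$, every function $f:\{-1,1\}^n\to X$ of degree at most $d$ satisfies $$\|\Delta f\|_{L_p(\{-1,1\}^n;X)}\leq(1-\eta)d^2\,\|f\|_{L_p(\{-1,1\}^n;X)}.$$ Then $X$ has finite cotype.
   Context: $\mathbb{N}=\{1,2,\ldots\}$. For $p\in[1,\infty)$, $\|f\|_{L_p(\{-1,1\}^n;X)}=\big(2^{-n}\sum_{\varepsilon\in\{-1,1\}^n}\|f(\varepsilon)\|_X^p\big)^{1/p}$, and $\|f\|_{L_\infty(\{-1,1\}^n;X)}=\max_{\varepsilon}\|f(\varepsilon)\|_X$. For $A\subseteq\{1,\ldots,n\}$, the Walsh function is $w_A(\varepsilon)=\prod_{i\in A}\varepsilon_i$. Every $f:\{-1,1\}^n\to X$ has the expansion $f=\sum_{A}\widehat f(A)w_A$ with $\widehat f(A)=2^{-n}\sum_{\delta\in\{-1,1\}^n}f(\delta)w_A(\delta)\in X$. The hypercube Laplacian is $\Delta f=\sum_A|A|\widehat f(A)w_A$. A function $f$ has degree at most $d$ if $\widehat f(A)=0$ whenever $|A|>d$. A Banach space $X$ has cotype $q\in[2,\infty)$ with constant $C\in(0,\infty)$ if for every $n\in\mathbb{N}$ and $x_1,\ldots,x_n\in X$, $\big(2^{-n}\sum_{\varepsilon\in\{-1,1\}^n}\|\sum_{i=1}^n\varepsilon_ix_i\|_X^q\big)^{1/q}\geq\frac1C\big(\sum_{i=1}^n\|x_i\|_X^q\big)^{1/q}$.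 $X$ has finite cotype if it has cotype $q$ with some constant $C<\infty$ for some $q\in[2,\infty)$. *)

theory Defs
  imports "HOL-Analysis.Analysis"
begin

(* Complex scalar multiplication extends the real one that every banach type already carries;
   the norm is homogeneous over the complex numbers. *)
class complex_normed_vector = real_normed_vector +
  fixes scaleC :: "complex \<Rightarrow> 'a \<Rightarrow> 'a"  (infixr \<open>*\<^sub>C\<close> 75)
  assumes scaleC_add_right: "a *\<^sub>C (x + y) = a *\<^sub>C x + a *\<^sub>C y"
    and scaleC_add_left: "(a + b) *\<^sub>C x = a *\<^sub>C x + b *\<^sub>C x"
    and scaleC_scaleC: "a *\<^sub>C (b *\<^sub>C x) = (a * b) *\<^sub>C x"
    and scaleC_one: "1 *\<^sub>C x = x"
    and scaleR_scaleC: "r *\<^sub>R x = complex_of_real r *\<^sub>C x"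
    and norm_scaleC: "norm (a *\<^sub>C x) = cmod a * norm x"

class complex_banach = complex_normed_vector + banach

instantiation complex :: complex_banach
begin

definition scaleC_complex :: "complex \<Rightarrow> complex \<Rightarrow> complex" where
  "scaleC_complex a x = a * x"

instance
  by standard
    (simp_all add: scaleC_complex_def algebra_simps scaleR_conv_of_real norm_mult)

end

(* Points are extensional functions, so the cube has exactly 2^n elements. Functions on the cube
   are total functions of which only the values on the cube are ever used. *)
definition hypercube :: "nat \<Rightarrow> (nat \<Rightarrow> real) set" where
  "hypercube n = {1..n} \<rightarrow>\<^sub>E {-1, 1}"

definition cube_Lp_norm ::
  "nat \<Rightarrow> ereal \<Rightarrow> ((nat \<Rightarrow> real) \<Rightarrow> 'a::real_normed_vector) \<Rightarrow> real" where
  "cube_Lp_norm n p f =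
     (if p = \<infinity> then Max ((\<lambda>\<epsilon>. norm (f \<epsilon>)) ` hypercube n)
      else ((\<Sum>\<epsilon>\<in>hypercube n. norm (f \<epsilon>) powr real_of_ereal p) / 2 ^ n)
             powr (1 / real_of_ereal p))"

definition walsh :: "nat set \<Rightarrow> (nat \<Rightarrow> real) \<Rightarrow> real" where
  "walsh A \<epsilon> = (\<Prod>i\<in>A. \<epsilon> i)"

definition fourier_coeff ::
  "nat \<Rightarrow> ((nat \<Rightarrow> real) \<Rightarrow> 'a::real_vector) \<Rightarrow> nat set \<Rightarrow> 'a" where
  "fourier_coeff n f A = (1 / 2 ^ n) *\<^sub>R (\<Sum>\<delta>\<in>hypercube n. walsh A \<delta> *\<^sub>R f \<delta>)"

definition cube_laplacian ::
  "nat \<Rightarrow> ((nat \<Rightarrow> real) \<Rightarrow> 'a::real_vector) \<Rightarrow> (nat \<Rightarrow> real) \<Rightarrow> 'a" where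
  "cube_laplacian n f \<epsilon> =
     (\<Sum>A\<in>Pow {1..n}. (real (card A) * walsh A \<epsilon>) *\<^sub>R fourier_coeff n f A)"

definition cube_degree_le ::
  "nat \<Rightarrow> ((nat \<Rightarrow> real) \<Rightarrow> 'a::real_vector) \<Rightarrow> nat \<Rightarrow> bool" where
  "cube_degree_le n f d \<longleftrightarrow> (\<forall>A \<subseteq> {1..n}. d < card A \<longrightarrow> fourier_coeff n f A = 0)"

definition has_cotype :: "'a::real_normed_vector itself \<Rightarrow> real \<Rightarrow> real \<Rightarrow> bool" where
  "has_cotype _ q C \<longleftrightarrow>
     (\<forall>n\<ge>1. \<forall>x :: nat \<Rightarrow> 'a.
        ((\<Sum>\<epsilon>\<in>hypercube n. norm (\<Sum>i=1..n. \<epsilon> i *\<^sub>R x i) powr q) / 2 ^ n) powr (1 / q)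
          \<ge> (1 / C) * (\<Sum>i=1..n. norm (x i) powr q) powr (1 / q))"

definition finite_cotype :: "'a::real_normed_vector itself \<Rightarrow> bool" where
  "finite_cotype T \<longleftrightarrow> (\<exists>q\<ge>2. \<exists>C>0. has_cotype T q C)"

end

theory Submission
  imports Defs
begin

text \<open>
  The constant \<open>d\<^sup>2\<close> cannot be improved over spaces that
  contain \<open>\<ell>\<^sub>\<infinity>\<^sup>N\<close> almost isometrically for every \<open>N\<close>, and a space that has no finite cotype is of
  this kind.

  \<^emph>\<open>The extremal function.\<close> Let \<open>T\<close> be the Chebyshev polynomial of degree \<open>d\<close>, let
  \<open>(x\<^sub>\<delta>)\<close>, indexed by \<open>\<delta> \<in> {-1, 1}\<^sup>n\<close>, behave like the unit vectors of \<open>\<ell>\<^sub>\<infinity>\<close>, and put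
  \<open>f \<epsilon> = (\<Sum>\<delta>. T ((\<Sum>i. \<epsilon> i * \<delta> i) / n) x\<^sub>\<delta>)\<close>. At every point of the cube the norm of \<open>f\<close> is almost
  at most \<open>1\<close>, because \<open>T\<close> is bounded by \<open>1\<close> on \<open>[-1, 1]\<close>. At every point \<open>\<epsilon>\<close> the
  Laplacian of \<open>f\<close> has a large coefficient, namely that of \<open>x\<^sub>\<epsilon>\<close>, which is
  \<open>(n / 2) (T 1 - T (1 - 2 / n))\<close> and tends to \<open>T' 1 = d\<^sup>2\<close> as \<open>n\<close> grows. Both estimates are pointwise,
  so they hold in every \<open>L\<^sub>p\<close> (\<open>chebyshev_function_on_cube\<close>).

  \<^emph>\<open>Finding \<open>\<ell>\<^sub>\<infinity>\<^sup>N\<close>.\<close> This is the case of infinite cotype of the theorem of Maurey and Pisier. Write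
  \<open>E(x)\<close> for the mean over all signs of \<open>\<parallel>\<Sum>i. \<epsilon> i x\<^sub>i\<parallel>\<^sup>2\<close>. Always \<open>\<parallel>x\<^sub>i\<parallel>\<^sup>2 \<le> E(x)\<close>, so the best
  constant \<open>a(N)\<close> in \<open>(\<Sum>i\<le>N. \<parallel>x\<^sub>i\<parallel>\<^sup>2) \<le> a(N) E(x)\<close> is at most \<open>N\<close>, and there are two cases.

  If \<open>a(N) < N\<close> for some \<open>N \<ge> 2\<close>, then since \<open>a\<close> is submultiplicative it grows along the
  powers of \<open>N\<close> like a power with exponent less than \<open>1\<close> (\<open>cotype_two_constant_powers\<close>). Applied to
  the largest vectors of a family this gives a polynomial decay of the decreasing rearrangement of their
  norms, and hence finite cotype (\<open>finite_cotype_of_improved_cotype_two_constant\<close>).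

  If \<open>a(N) = N\<close> for every \<open>N \<ge> 2\<close>, there are \<open>x\<^sub>1, \<dots>, x\<^sub>N\<close> with \<open>E(x) = 1\<close> and all norms close to \<open>1\<close>.
  Then \<open>\<parallel>\<Sum>i. \<epsilon> i x\<^sub>i\<parallel>\<close> has second moment \<open>1\<close> and mean close to \<open>1\<close>, so its variance is close to \<open>0\<close>;
  as the probability space has just \<open>2\<^sup>N\<close> points, it is uniformly close to \<open>1\<close>
  (\<open>almost_isometric_sup_norm_vectors\<close>). Such vectors span a copy of \<open>\<ell>\<^sub>\<infinity>\<^sup>N\<close> up to a factor close to
  \<open>1\<close> (\<open>norm_sum_le_of_hypercube\<close>, \<open>norm_sum_ge_of_hypercube\<close>).
\<close>

section \<open>Moments of random signed sums\<close>

lemma finite_hypercube [simp]: "finite (hypercube n)"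
  unfolding hypercube_def by (intro finite_PiE) auto

lemma card_hypercube: "card (hypercube n) = 2 ^ n"
proof -
  have "card {-1, 1 :: real} = 2"
    by simp
  then show ?thesis
    unfolding hypercube_def by (simp only: card_PiE finite_atLeastAtMost
        prod_constant card_atLeastAtMost diff_Suc_1)
qed

lemma hypercube_nonempty [simp]: "hypercube n \<noteq> {}"
  using card_hypercube[of n] by (metis card.empty power_eq_0_iff zero_neq_numeral)

lemma hypercube_coord: "\<epsilon> \<in> hypercube n \<Longrightarrow> i \<in> {1..n} \<Longrightarrow> \<epsilon> i \<in> {-1, 1}"
  unfolding hypercube_def by auto

text \<open>
  Points of the cube are extensional, so the product of two sign vectors is cut off outside
  \<open>{1..n}\<close> to be a point of the cube again.
\<close>

definition multiply_signs :: "nat \<Rightarrow> (nat \<Rightarrow> real) \<Rightarrow> (nat \<Rightarrow> real) \<Rightarrow> (nat \<Rightarrow> real)" where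
  "multiply_signs n \<sigma> \<epsilon> = (\<lambda>i\<in>{1..n}. \<sigma> i * \<epsilon> i)"

lemma bij_betw_multiply_signs:
  assumes "\<And>i. i \<in> {1..n} \<Longrightarrow> \<sigma> i \<in> {-1, 1}"
  shows "bij_betw (multiply_signs n \<sigma>) (hypercube n) (hypercube n)"
proof (rule bij_betw_byWitness[where f' = "multiply_signs n \<sigma>"])
  have sq: "\<sigma> i * \<sigma> i = 1" if "i \<in> {1..n}" for i
    using assms[OF that] by auto
  have inv: "multiply_signs n \<sigma> (multiply_signs n \<sigma> \<epsilon>) = \<epsilon>" if "\<epsilon> \<in> hypercube n" for \<epsilon>
  proof
    fix i
    show "multiply_signs n \<sigma> (multiply_signs n \<sigma> \<epsilon>) i = \<epsilon> i"
    proof (cases "i \<in> {1..n}")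
      case True
      then show ?thesis
        using sq[OF True] by (simp add: multiply_signs_def mult.assoc[symmetric])
    next
      case False
      then show ?thesis
        using that unfolding hypercube_def multiply_signs_def by (auto simp: PiE_def extensional_def)
    qed
  qed
  then show "\<forall>\<epsilon>\<in>hypercube n. multiply_signs n \<sigma> (multiply_signs n \<sigma> \<epsilon>) = \<epsilon>"
    and "\<forall>\<epsilon>\<in>hypercube n. multiply_signs n \<sigma> (multiply_signs n \<sigma> \<epsilon>) = \<epsilon>"
    by auto
  have "multiply_signs n \<sigma> \<epsilon> \<in> hypercube n" if "\<epsilon> \<in> hypercube n" for \<epsilon>
    unfolding hypercube_def multiply_signs_def
    by (rule restrict_PiE_iff[THEN iffD2]) (use assms hypercube_coord[OF that] in fastforce)
  then show "multiply_signs n \<sigma> ` hypercube n \<subseteq> hypercube n"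
    and "multiply_signs n \<sigma> ` hypercube n \<subseteq> hypercube n"
    by auto
qed

text \<open>
  The signs range over the full cube even when the sum runs over a smaller set \<open>J\<close>. Moments for
  different \<open>J\<close> thus live on one probability space, and no marginal distributions are needed.
\<close>

definition rademacher_moment ::
  "nat \<Rightarrow> nat set \<Rightarrow> nat \<Rightarrow> (nat \<Rightarrow> 'a::real_normed_vector) \<Rightarrow> real" where
  "rademacher_moment n J m x =
     (\<Sum>\<epsilon>\<in>hypercube n. norm (\<Sum>i\<in>J. \<epsilon> i *\<^sub>R x i) ^ m) / 2 ^ n"

lemma rademacher_moment_nonneg: "0 \<le> rademacher_moment n J m x"
  unfolding rademacher_moment_def by (intro divide_nonneg_nonneg sum_nonneg) auto

lemma rademacher_moment_multiply_signs:
  assumes "J \<subseteq> {1..n}" and "\<And>i. i \<in> {1..n} \<Longrightarrow> \<sigma> i \<in> {-1, 1}"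
  shows "rademacher_moment n J m (\<lambda>i. \<sigma> i *\<^sub>R x i) = rademacher_moment n J m x"
proof -
  have "(\<Sum>\<epsilon>\<in>hypercube n. norm (\<Sum>i\<in>J. \<epsilon> i *\<^sub>R x i) ^ m) =
        (\<Sum>\<epsilon>\<in>hypercube n. norm (\<Sum>i\<in>J. multiply_signs n \<sigma> \<epsilon> i *\<^sub>R x i) ^ m)"
    by (rule sum.reindex_bij_betw[OF bij_betw_multiply_signs[OF assms(2)], symmetric])
  also have "\<dots> = (\<Sum>\<epsilon>\<in>hypercube n. norm (\<Sum>i\<in>J. \<epsilon> i *\<^sub>R \<sigma> i *\<^sub>R x i) ^ m)"
  proof (intro sum.cong refl arg_cong[where f = "\<lambda>v. norm v ^ m"])
    fix \<epsilon> i assume "i \<in> J"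
    then show "multiply_signs n \<sigma> \<epsilon> i *\<^sub>R x i = \<epsilon> i *\<^sub>R \<sigma> i *\<^sub>R x i"
      using assms(1) by (auto simp: multiply_signs_def mult.commute)
  qed
  finally show ?thesis
    unfolding rademacher_moment_def by simp
qed

lemma convex_on_power_nonneg: "convex_on {0::real..} (\<lambda>x. x ^ m)"
proof (cases "even m")
  case True
  then show ?thesis
    using convex_on_subset[OF convex_power_even[OF True], of "{0..}"] by simp
qed (rule convex_power_odd)

lemma norm_midpoint_power_le:
  fixes a b :: "'a::real_normed_vector"
  shows "norm ((1 / 2) *\<^sub>R (a + b)) ^ m \<le> (norm a ^ m + norm b ^ m) / 2"
proof -
  have "norm ((1 / 2) *\<^sub>R (a + b)) \<le> (norm a + norm b) / 2"
    using norm_triangle_ineq[of a b] by simp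
  then have "norm ((1 / 2) *\<^sub>R (a + b)) ^ m \<le> ((norm a + norm b) / 2) ^ m"
    by (rule power_mono) simp
  also have "\<dots> \<le> (norm a ^ m + norm b ^ m) / 2"
    using convex_onD[OF convex_on_power_nonneg[of m], of "1 / 2" "norm a" "norm b"]
    by (simp add: add_divide_distrib)
  finally show ?thesis .
qed

text \<open>
  A sum over \<open>J\<close> is the midpoint of two signed sums over \<open>I\<close>, one with the given signs and one with
  the signs outside \<open>J\<close> reversed. These two are equidistributed, and \<open>v \<mapsto> \<parallel>v\<parallel>\<^sup>m\<close> is convex.
\<close>

lemma rademacher_moment_mono:
  assumes JI: "J \<subseteq> I" and I: "I \<subseteq> {1..n}"
  shows "rademacher_moment n J m x \<le> rademacher_moment n I m x"
proof -
  define \<sigma> :: "nat \<Rightarrow> real" where "\<sigma> i = (if i \<in> J then 1 else -1)" for i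
  have fin: "finite I"
    using I finite_subset by blast
  have half: "(\<Sum>i\<in>J. \<epsilon> i *\<^sub>R x i) =
      (1 / 2) *\<^sub>R ((\<Sum>i\<in>I. \<epsilon> i *\<^sub>R x i) + (\<Sum>i\<in>I. \<epsilon> i *\<^sub>R \<sigma> i *\<^sub>R x i))" for \<epsilon>
  proof -
    have "(\<Sum>i\<in>J. \<epsilon> i *\<^sub>R x i) = (\<Sum>i\<in>I. if i \<in> J then \<epsilon> i *\<^sub>R x i else 0)"
      using JI fin by (simp add: sum.If_cases Int_absorb1)
    also have "\<dots> = (\<Sum>i\<in>I. (1 / 2) *\<^sub>R (\<epsilon> i *\<^sub>R x i + \<epsilon> i *\<^sub>R \<sigma> i *\<^sub>R x i))"
      by (intro sum.cong refl) (auto simp: \<sigma>_def simp flip: scaleR_add_left)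
    finally show ?thesis
      by (simp only: scaleR_right.sum sum.distrib scaleR_add_right)
  qed
  have "(\<Sum>\<epsilon>\<in>hypercube n. norm (\<Sum>i\<in>J. \<epsilon> i *\<^sub>R x i) ^ m) \<le>
     (\<Sum>\<epsilon>\<in>hypercube n. (norm (\<Sum>i\<in>I. \<epsilon> i *\<^sub>R x i) ^ m
        + norm (\<Sum>i\<in>I. \<epsilon> i *\<^sub>R \<sigma> i *\<^sub>R x i) ^ m) / 2)"
    unfolding half by (intro sum_mono norm_midpoint_power_le)
  then have "rademacher_moment n J m x \<le>
      (rademacher_moment n I m x + rademacher_moment n I m (\<lambda>i. \<sigma> i *\<^sub>R x i)) / 2"
    unfolding rademacher_moment_def
    unfolding sum_divide_distrib[symmetric] sum.distrib add_divide_distrib[symmetric]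
    using divide_right_mono[of _ _ "2 ^ n"] by (fastforce simp: field_simps)
  also have "rademacher_moment n I m (\<lambda>i. \<sigma> i *\<^sub>R x i) = rademacher_moment n I m x"
    by (rule rademacher_moment_multiply_signs[OF I]) (simp add: \<sigma>_def)
  finally show ?thesis by simp
qed

lemma rademacher_moment_single:
  assumes "i \<in> {1..n}"
  shows "rademacher_moment n {i} m x = norm (x i) ^ m"
proof -
  have "norm (\<epsilon> i *\<^sub>R x i) = norm (x i)" if "\<epsilon> \<in> hypercube n" for \<epsilon>
    using hypercube_coord[OF that assms] by (auto simp only: insert_iff empty_iff) auto
  then have "rademacher_moment n {i} m x = (\<Sum>\<epsilon>\<in>hypercube n. norm (x i) ^ m) / 2 ^ n"
    unfolding rademacher_moment_def by (simp del: norm_scaleR)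
  then show ?thesis
    by (simp add: card_hypercube)
qed

lemma norm_power_le_rademacher_moment:
  assumes "i \<in> {1..n}"
  shows "norm (x i) ^ m \<le> rademacher_moment n {1..n} m x"
  using rademacher_moment_mono[of "{i}" "{1..n}" n m x] rademacher_moment_single[OF assms, of m x] assms
  by simp

section \<open>Submultiplicativity of cotype constants\<close>

lemma partition_into_equal_blocks:
  fixes B :: "nat set"
  assumes "card B = N * M" "finite B"
  shows "\<exists>b. b ` B \<subseteq> {1..N} \<and> (\<forall>j\<in>{1..N}. card {i \<in> B. b i = j} = M)"
  using assms
proof (induction N arbitrary: B)
  case 0
  then show ?case by simp
next
  case (Suc N)
  obtain S where S: "S \<subseteq> B" "card S = M" "finite S"
    using obtain_subset_with_card_n[of M B] Suc.prems by auto
  have "card (B - S) = N * M"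
    using S Suc.prems by (simp add: card_Diff_subset)
  then obtain b where b: "b ` (B - S) \<subseteq> {1..N}"
      "\<forall>j\<in>{1..N}. card {i \<in> B - S. b i = j} = M"
    using Suc.IH[of "B - S"] Suc.prems by auto
  define b' where "b' i = (if i \<in> S then Suc N else b i)" for i
  have "b' ` B \<subseteq> {1..Suc N}"
    using b(1) by (auto simp: b'_def)
  moreover have "card {i \<in> B. b' i = j} = M" if j: "j \<in> {1..Suc N}" for j
  proof (cases "j = Suc N")
    case True
    have "{i \<in> B. b' i = j} = S"
      using S(1) b(1) True by (force simp: b'_def split: if_splits)
    then show ?thesis using S by simp
  next
    case False
    have "{i \<in> B. b' i = j} = {i \<in> B - S. b i = j}"
      using False by (auto simp: b'_def)
    then show ?thesis using b(2) j False by auto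
  qed
  ultimately show ?case by blast
qed

text \<open>
  Independent signs \<open>\<epsilon> j\<close>, one for each block \<open>{i \<in> B. b i = j}\<close>, may be multiplied into the signs
  \<open>\<delta> i\<close> without changing their distribution. A random signed sum over \<open>B\<close> is thus a random
  signed sum of the block sums, whose own signs are random too. This is what makes the cotype constants
  submultiplicative.
\<close>

lemma rademacher_moment_blocks:
  fixes x :: "nat \<Rightarrow> 'a::real_normed_vector"
  assumes B: "B \<subseteq> {1..n}" and b: "b ` B \<subseteq> {1..N}"
  shows "rademacher_moment n B m x =
    (\<Sum>\<delta>\<in>hypercube n. rademacher_moment N {1..N} m (\<lambda>j. \<Sum>i\<in>{i \<in> B. b i = j}. \<delta> i *\<^sub>R x i)) / 2 ^ n"
proof -
  have finB: "finite B"
    using B finite_subset by blast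
  define \<sigma> :: "(nat \<Rightarrow> real) \<Rightarrow> nat \<Rightarrow> real" where
    "\<sigma> \<epsilon> i = (if i \<in> B then \<epsilon> (b i) else 1)" for \<epsilon> i
  have group: "(\<Sum>i\<in>B. \<delta> i *\<^sub>R \<sigma> \<epsilon> i *\<^sub>R x i) =
      (\<Sum>j\<in>{1..N}. \<epsilon> j *\<^sub>R (\<Sum>i\<in>{i \<in> B. b i = j}. \<delta> i *\<^sub>R x i))" for \<delta> \<epsilon>
  proof -
    have "(\<Sum>j\<in>{1..N}. \<epsilon> j *\<^sub>R (\<Sum>i\<in>{i \<in> B. b i = j}. \<delta> i *\<^sub>R x i)) =
          (\<Sum>j\<in>{1..N}. \<Sum>i\<in>{i \<in> B. b i = j}. \<delta> i *\<^sub>R \<sigma> \<epsilon> i *\<^sub>R x i)"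
      unfolding scaleR_right.sum
      by (intro sum.cong refl) (simp add: \<sigma>_def mult.commute)
    also have "\<dots> = (\<Sum>i\<in>B. \<delta> i *\<^sub>R \<sigma> \<epsilon> i *\<^sub>R x i)"
      by (rule sum.group[OF finB _ b]) simp
    finally show ?thesis ..
  qed
  have "rademacher_moment n B m x = rademacher_moment n B m (\<lambda>i. \<sigma> \<epsilon> i *\<^sub>R x i)"
    if "\<epsilon> \<in> hypercube N" for \<epsilon>
    by (rule rademacher_moment_multiply_signs[OF B, symmetric])
       (use b hypercube_coord[OF that] in \<open>force simp: \<sigma>_def\<close>)
  then have "(\<Sum>\<epsilon>\<in>hypercube N. rademacher_moment n B m x) =
      (\<Sum>\<epsilon>\<in>hypercube N. rademacher_moment n B m (\<lambda>i. \<sigma> \<epsilon> i *\<^sub>R x i))"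
    by (intro sum.cong) auto
  then have "2 ^ N * rademacher_moment n B m x =
      (\<Sum>\<epsilon>\<in>hypercube N. rademacher_moment n B m (\<lambda>i. \<sigma> \<epsilon> i *\<^sub>R x i))"
    by (simp add: card_hypercube)
  also have "\<dots> = (\<Sum>\<epsilon>\<in>hypercube N. (\<Sum>\<delta>\<in>hypercube n.
      norm (\<Sum>j\<in>{1..N}. \<epsilon> j *\<^sub>R (\<Sum>i\<in>{i \<in> B. b i = j}. \<delta> i *\<^sub>R x i)) ^ m) / 2 ^ n)"
    unfolding rademacher_moment_def group ..
  also have "\<dots> = (\<Sum>\<delta>\<in>hypercube n. (\<Sum>\<epsilon>\<in>hypercube N.
      norm (\<Sum>j\<in>{1..N}. \<epsilon> j *\<^sub>R (\<Sum>i\<in>{i \<in> B. b i = j}. \<delta> i *\<^sub>R x i)) ^ m)) / 2 ^ n"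
    by (subst sum.swap) (simp add: sum_divide_distrib)
  finally show ?thesis
    unfolding rademacher_moment_def
    by (simp add: field_simps flip: sum_divide_distrib)
qed

text \<open>
  The submultiplicativity of cotype \<open>2\<close> constants, iterated: cut \<open>B\<close> into \<open>N\<close> blocks of
  \<open>N ^ k\<close> elements, use the induction hypothesis in each block, and then the case of \<open>N\<close> vectors for the
  \<open>N\<close> block sums at each choice of signs.
\<close>

lemma cotype_two_constant_powers:
  fixes x :: "nat \<Rightarrow> 'a::real_normed_vector"
  assumes base: "\<And>y :: nat \<Rightarrow> 'a.
      (\<Sum>i\<in>{1..N}. (norm (y i))\<^sup>2) \<le> N * \<rho> * rademacher_moment N {1..N} 2 y"
    and \<rho>: "0 \<le> \<rho>"
    and B: "B \<subseteq> {1..n}" "card B = N ^ k"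
  shows "(\<Sum>i\<in>B. (norm (x i))\<^sup>2) \<le> (N * \<rho>) ^ k * rademacher_moment n B 2 x"
  using B
proof (induction k arbitrary: B)
  case 0
  then obtain i where "B = {i}"
    by (auto simp: card_1_singleton_iff)
  with 0 show ?case
    using rademacher_moment_single[of i n 2 x] by simp
next
  case (Suc k)
  have finB: "finite B"
    using Suc.prems finite_subset by blast
  obtain b where b: "b ` B \<subseteq> {1..N}" "\<And>j. j \<in> {1..N} \<Longrightarrow> card {i \<in> B. b i = j} = N ^ k"
    using partition_into_equal_blocks[of B N "N ^ k"] Suc.prems finB by auto
  define S where "S j = {i \<in> B. b i = j}" for j
  have "(\<Sum>i\<in>B. (norm (x i))\<^sup>2) = (\<Sum>j\<in>{1..N}. \<Sum>i\<in>S j. (norm (x i))\<^sup>2)"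
    unfolding S_def by (rule sum.group[OF finB _ b(1), symmetric]) simp
  also have "\<dots> \<le> (\<Sum>j\<in>{1..N}. (N * \<rho>) ^ k * rademacher_moment n (S j) 2 x)"
    by (intro sum_mono Suc.IH) (use b(2) Suc.prems in \<open>auto simp: S_def\<close>)
  also have "\<dots> = (N * \<rho>) ^ k *
      ((\<Sum>\<delta>\<in>hypercube n. \<Sum>j\<in>{1..N}. (norm (\<Sum>i\<in>S j. \<delta> i *\<^sub>R x i))\<^sup>2) / 2 ^ n)"
    unfolding rademacher_moment_def
    by (subst sum.swap) (simp add: sum_distrib_left sum_divide_distrib)
  also have "\<dots> \<le> (N * \<rho>) ^ k * ((\<Sum>\<delta>\<in>hypercube n.
      N * \<rho> * rademacher_moment N {1..N} 2 (\<lambda>j. \<Sum>i\<in>S j. \<delta> i *\<^sub>R x i)) / 2 ^ n)"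
    using \<rho> by (intro mult_left_mono divide_right_mono sum_mono base) auto
  also have "\<dots> = (N * \<rho>) ^ Suc k * rademacher_moment n B 2 x"
    unfolding rademacher_moment_blocks[OF Suc.prems(1) b(1)] S_def
    by (simp add: sum_distrib_left sum_divide_distrib mult_ac)
  finally show ?case .
qed

section \<open>Finite cotype from an improved constant\<close>

lemma sum_inverse_squares_le_2: "(\<Sum>k=1..n. 1 / (real k)\<^sup>2) \<le> 2"
proof -
  have "(\<Sum>k=1..n. 1 / (real k)\<^sup>2) \<le> 2 - 1 / real n"
  proof (induction n)
    case (Suc n)
    show ?case
    proof (cases "n = 0")
      case False
      then have "1 / (real (Suc n))\<^sup>2 \<le> 1 / (real n * real (Suc n))"
        by (intro divide_left_mono) (auto simp: power2_eq_square)
      also have "\<dots> = 1 / real n - 1 / real (Suc n)"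
        using False by (simp add: field_simps)
      finally show ?thesis
        using Suc.IH by simp
    qed simp
  qed simp
  also have "\<dots> \<le> 2" by simp
  finally show ?thesis .
qed

text \<open>
  The hypothesis says that the \<open>k\<close>-th largest value of \<open>g\<close> is at most \<open>K / k\<close>. Removing a smallest
  element again and again avoids having to sort the values.
\<close>

lemma sum_squares_le_of_min_bound:
  fixes g :: "'b \<Rightarrow> real"
  assumes "finite I" and "\<And>i. i \<in> I \<Longrightarrow> 0 \<le> g i"
    and "\<And>J. J \<subseteq> I \<Longrightarrow> J \<noteq> {} \<Longrightarrow> \<exists>i\<in>J. g i \<le> K / card J"
  shows "(\<Sum>i\<in>I. (g i)\<^sup>2) \<le> K\<^sup>2 * (\<Sum>k=1..card I. 1 / (real k)\<^sup>2)"
  using assms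
proof (induction "card I" arbitrary: I)
  case 0
  then show ?case by simp
next
  case (Suc m)
  then have "I \<noteq> {}" by auto
  then obtain i where i: "i \<in> I" "g i \<le> K / card I"
    using Suc.prems(3)[of I] by auto
  have m: "card (I - {i}) = m"
    using Suc.hyps(2) i Suc.prems(1) by simp
  have "(\<Sum>i\<in>I - {i}. (g i)\<^sup>2) \<le> K\<^sup>2 * (\<Sum>k=1..card (I - {i}). 1 / (real k)\<^sup>2)"
    using Suc.prems by (intro Suc.hyps(1) m[symmetric]) (auto simp: subset_Diff_insert)
  moreover have "(g i)\<^sup>2 \<le> (K / card I)\<^sup>2"
    using i Suc.prems(2) by (intro power_mono) auto
  moreover have "(\<Sum>k=1..card I. 1 / (real k)\<^sup>2) =
      (\<Sum>k=1..card (I - {i}). 1 / (real k)\<^sup>2) + 1 / (real (card I))\<^sup>2"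
    unfolding m by (simp flip: Suc.hyps(2))
  moreover have "(\<Sum>i\<in>I. (g i)\<^sup>2) = (g i)\<^sup>2 + (\<Sum>i\<in>I - {i}. (g i)\<^sup>2)"
    using Suc.prems(1) i by (simp add: sum.remove)
  ultimately show ?case
    by (simp add: algebra_simps power_divide)
qed

lemma power_sandwich:
  fixes m N :: nat
  assumes "2 \<le> N" "1 \<le> m"
  obtains k where "N ^ k \<le> m" "m < N ^ Suc k"
proof -
  have "\<exists>k. m < N ^ Suc k"
  proof
    have "m < 2 ^ m" by simp
    also have "\<dots> \<le> N ^ m" using assms by (simp add: power_mono)
    also have "\<dots> \<le> N ^ Suc m" using assms by simp
    finally show "m < N ^ Suc m" .
  qed
  then have l: "m < N ^ Suc (LEAST k. m < N ^ Suc k)" (is "m < N ^ Suc ?k")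
    by (rule LeastI_ex)
  have "N ^ ?k \<le> m"
  proof (cases ?k)
    case 0
    then show ?thesis using assms by simp
  next
    case (Suc j)
    then have "\<not> m < N ^ Suc j"
      by (metis lessI not_less_Least)
    then show ?thesis using Suc by simp
  qed
  with l show ?thesis using that by blast
qed

lemma power_average_le_average_power:
  fixes a :: "'b \<Rightarrow> real"
  assumes "finite A" "A \<noteq> {}" "\<And>i. i \<in> A \<Longrightarrow> 0 \<le> a i"
  shows "((\<Sum>i\<in>A. a i) / card A) ^ s \<le> (\<Sum>i\<in>A. a i ^ s) / card A"
proof -
  have "(\<Sum>i\<in>A. (1 / card A) *\<^sub>R a i) ^ s \<le> (\<Sum>i\<in>A. (1 / card A) * a i ^ s)"
    by (rule convex_on_sum[OF assms(1,2) convex_on_power_nonneg]) (use assms in auto)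
  then show ?thesis
    by (simp add: sum_divide_distrib)
qed

lemma rademacher_moment_power_le:
  "rademacher_moment n J 2 x ^ s \<le> rademacher_moment n J (2 * s) x"
  using power_average_le_average_power[of "hypercube n" "\<lambda>\<epsilon>. (norm (\<Sum>i\<in>J. \<epsilon> i *\<^sub>R x i))\<^sup>2" s]
  by (simp add: rademacher_moment_def card_hypercube power_mult)

text \<open>
  Write \<open>E\<close> for the second moment of the whole sum. Among at least \<open>N ^ k\<close> of the vectors, some
  \<open>x i\<close> satisfies \<open>(norm (x i))\<^sup>2 \<le> \<rho> ^ k * E\<close>. Raised to the power \<open>s\<close>, the gain \<open>\<rho> ^ k\<close> turns into
  at most \<open>1 / N ^ k\<close>, which makes \<open>norm (x i) ^ (2 * s)\<close> decay, up to the factor \<open>N * E ^ s\<close>, at least as fast as the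
  inverse of the rank of \<open>x i\<close>. Squares of these numbers are summable, whence the exponent \<open>4 * s\<close>.
\<close>

lemma sum_norm_powers_le_rademacher_moment:
  fixes x :: "nat \<Rightarrow> 'a::real_normed_vector"
  assumes N: "2 \<le> N" and \<rho>: "0 \<le> \<rho>" and s: "\<rho> ^ s \<le> 1 / N"
    and base: "\<And>y :: nat \<Rightarrow> 'a.
      (\<Sum>i\<in>{1..N}. (norm (y i))\<^sup>2) \<le> N * \<rho> * rademacher_moment N {1..N} 2 y"
  shows "(\<Sum>i\<in>{1..n}. norm (x i) ^ (4 * s)) \<le>
    2 * (real N)\<^sup>2 * rademacher_moment n {1..n} (4 * s) x"
proof -
  define E where "E = rademacher_moment n {1..n} 2 x"
  have E: "0 \<le> E"
    unfolding E_def by (rule rademacher_moment_nonneg)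
  have "(\<Sum>i\<in>{1..n}. (norm (x i) ^ (2 * s))\<^sup>2) \<le>
      (N * E ^ s)\<^sup>2 * (\<Sum>k=1..card {1..n}. 1 / (real k)\<^sup>2)"
  proof (rule sum_squares_le_of_min_bound)
    fix J :: "nat set"
    assume J: "J \<subseteq> {1..n}" "J \<noteq> {}"
    then have finJ: "finite J"
      using finite_subset by blast
    then have "1 \<le> card J"
      using J by (simp add: Suc_leI card_gt_0_iff)
    then obtain k where k: "N ^ k \<le> card J" "card J < N ^ Suc k"
      using power_sandwich[OF N] by blast
    obtain B where B: "B \<subseteq> J" "card B = N ^ k"
      using obtain_subset_with_card_n[OF k(1)] by metis
    have "B \<noteq> {}" "finite B"
      using B N finJ finite_subset by auto
    have "\<exists>i\<in>B. (norm (x i))\<^sup>2 \<le> \<rho> ^ k * E"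
    proof (rule ccontr)
      assume "\<not> ?thesis"
      then have "(\<Sum>i\<in>B. \<rho> ^ k * E) < (\<Sum>i\<in>B. (norm (x i))\<^sup>2)"
        using \<open>B \<noteq> {}\<close> \<open>finite B\<close> by (intro sum_strict_mono) auto
      also have "\<dots> \<le> (N * \<rho>) ^ k * rademacher_moment n B 2 x"
        by (rule cotype_two_constant_powers[OF base \<rho>]) (use B J in auto)
      also have "\<dots> \<le> (N * \<rho>) ^ k * E"
        unfolding E_def using B J \<rho> by (intro mult_left_mono rademacher_moment_mono) auto
      finally show False
        using B by (simp add: power_mult_distrib)
    qed
    then obtain i where i: "i \<in> B" "(norm (x i))\<^sup>2 \<le> \<rho> ^ k * E" by blast
    \<comment> \<open>The factor \<open>N\<close> lost below pays for rounding \<open>card J\<close> down to a power of \<open>N\<close>.\<close>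
    have "norm (x i) ^ (2 * s) \<le> (\<rho> ^ k * E) ^ s"
      using power_mono[OF i(2), of s] by (simp add: power_mult)
    also have "\<dots> = (\<rho> ^ s) ^ k * E ^ s"
      by (simp add: power_mult_distrib flip: power_mult) (simp add: mult.commute)
    also have "\<dots> \<le> (1 / N) ^ k * E ^ s"
      using s \<rho> E by (intro mult_right_mono power_mono) auto
    also have "\<dots> \<le> N / card J * E ^ s"
    proof (intro mult_right_mono)
      have "real (card J) \<le> real (N ^ Suc k)"
        using k(2) by linarith
      then show "(1 / real N) ^ k \<le> real N / real (card J)"
        using N \<open>1 \<le> card J\<close> by (simp add: field_simps)
    qed (use E in simp)
    finally show "\<exists>i\<in>J. norm (x i) ^ (2 * s) \<le> N * E ^ s / card J"
      using i B by auto
  qed auto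
  also have "\<dots> \<le> (N * E ^ s)\<^sup>2 * 2"
    by (intro mult_left_mono sum_inverse_squares_le_2) simp
  also have "\<dots> = 2 * (real N)\<^sup>2 * E ^ (2 * s)"
    by (simp add: power_mult_distrib power_mult power2_eq_square mult_ac)
  also have "\<dots> \<le> 2 * (real N)\<^sup>2 * rademacher_moment n {1..n} (4 * s) x"
    unfolding E_def using rademacher_moment_power_le[of n "{1..n}" x "2 * s"]
    by (intro mult_left_mono) auto
  finally show ?thesis
    by (simp add: mult.commute flip: power_mult)
qed

lemma finite_cotype_of_improved_cotype_two_constant:
  assumes N: "2 \<le> N" and \<rho>: "0 \<le> \<rho>" "\<rho> < 1"
    and base: "\<And>y :: nat \<Rightarrow> 'a::real_normed_vector.
      (\<Sum>i\<in>{1..N}. (norm (y i))\<^sup>2) \<le> N * \<rho> * rademacher_moment N {1..N} 2 y"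
  shows "finite_cotype TYPE('a::real_normed_vector)"
proof -
  have "0 < 1 / real N"
    using N by simp
  then obtain s where s: "\<rho> ^ s < 1 / N"
    using real_arch_pow_inv[of "1 / N" \<rho>] \<rho> by auto
  have s0: "s \<noteq> 0"
    using s N by (intro notI) simp
  define q where "q = real (4 * s)"
  define C where "C = (2 * (real N)\<^sup>2) powr (1 / q)"
  have q: "2 \<le> q" "0 < q"
    unfolding q_def using s0 by auto
  have C: "0 < C"
    unfolding C_def using N by simp
  have pw: "norm v powr q = norm v ^ (4 * s)" for v :: 'a
    unfolding q_def using s0 by (intro powr_realpow') auto
  have "has_cotype TYPE('a) q C"
    unfolding has_cotype_def
  proof (intro allI impI)
    fix n :: nat and x :: "nat \<Rightarrow> 'a"
    have "(\<Sum>i=1..n. norm (x i) powr q) powr (1 / q) \<le>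
        (2 * (real N)\<^sup>2 * rademacher_moment n {1..n} (4 * s) x) powr (1 / q)"
      unfolding pw using s \<rho> q N
      by (intro powr_mono2 sum_norm_powers_le_rademacher_moment[OF _ _ _ base, of s] sum_nonneg) auto
    also have "\<dots> = C * rademacher_moment n {1..n} (4 * s) x powr (1 / q)"
      unfolding C_def by (rule powr_mult)
    finally show "((\<Sum>\<epsilon>\<in>hypercube n. norm (\<Sum>i=1..n. \<epsilon> i *\<^sub>R x i) powr q) / 2 ^ n) powr (1 / q)
          \<ge> (1 / C) * (\<Sum>i=1..n. norm (x i) powr q) powr (1 / q)"
      unfolding pw rademacher_moment_def using C by (simp add: field_simps)
  qed
  with q C show ?thesis
    unfolding finite_cotype_def by blast
qed

section \<open>Almost isometric copies of finite-dimensional sup-norm spaces\<close>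

text \<open>
  Vectors which almost attain the trivial cotype \<open>2\<close> constant \<open>N\<close> must all have almost the
  norm which is the largest one possible, \<open>sqrt R\<close> with \<open>R\<close> the second moment. After scaling to \<open>R = 1\<close>,
  the norm \<open>S\<close> of the random sum has mean at least \<open>1 - N * \<kappa>\<close> and second moment \<open>1\<close>, so \<open>(S - 1)\<^sup>2\<close> has
  a small mean. The defect \<open>\<kappa>\<close> is chosen after \<open>N\<close>, so
  small that the pointwise bound, which is \<open>2 ^ N\<close> times larger than that mean, is still at most \<open>\<tau>\<^sup>2\<close>.
\<close>

lemma almost_isometric_sup_norm_vectors:
  assumes no_cotype: "\<not> finite_cotype TYPE('a::real_normed_vector)"
    and N: "2 \<le> N" and \<tau>: "0 < \<tau>" "\<tau> \<le> 1"
  obtains x :: "nat \<Rightarrow> 'a::real_normed_vector" where "\<And>i. i \<in> {1..N} \<Longrightarrow> 1 - \<tau> \<le> norm (x i)"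
    and "\<And>\<epsilon>. \<epsilon> \<in> hypercube N \<Longrightarrow> norm (\<Sum>i\<in>{1..N}. \<epsilon> i *\<^sub>R x i) \<le> 1 + \<tau>"
proof -
  define \<kappa> where "\<kappa> = \<tau>\<^sup>2 / (2 ^ (N + 1) * N)"
  have N0: "real N > 0" using N by simp
  have \<kappa>0: "0 < \<kappa>"
    unfolding \<kappa>_def using \<tau> N0 by simp
  have \<kappa>N: "N * \<kappa> = \<tau>\<^sup>2 / 2 ^ (N + 1)"
    unfolding \<kappa>_def using N0 by simp
  have "\<tau>\<^sup>2 \<le> \<tau>"
    using \<tau> by (simp add: power2_eq_square mult_left_le)
  moreover have "\<tau>\<^sup>2 / 2 ^ (N + 1) \<le> \<tau>\<^sup>2 / 1"
    by (intro divide_left_mono one_le_power) auto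
  ultimately have \<kappa>\<tau>: "N * \<kappa> \<le> \<tau>"
    unfolding \<kappa>N by simp
  have "1 * \<kappa> \<le> N * \<kappa>"
    using N \<kappa>0 by (intro mult_right_mono) auto
  then have \<kappa>1: "\<kappa> \<le> 1"
    using \<kappa>\<tau> \<tau> by simp
  have "\<exists>y :: nat \<Rightarrow> 'a. N * (1 - \<kappa>) * rademacher_moment N {1..N} 2 y < (\<Sum>i\<in>{1..N}. (norm (y i))\<^sup>2)"
  proof (rule ccontr)
    assume "\<not> ?thesis"
    then have "finite_cotype TYPE('a)"
      using \<kappa>0 \<kappa>1 by (intro finite_cotype_of_improved_cotype_two_constant[OF N, of "1 - \<kappa>"]) (auto simp: not_less)
    with no_cotype show False ..
  qed
  then obtain y :: "nat \<Rightarrow> 'a" where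
    y: "N * (1 - \<kappa>) * rademacher_moment N {1..N} 2 y < (\<Sum>i\<in>{1..N}. (norm (y i))\<^sup>2)" ..
  define R where "R = rademacher_moment N {1..N} 2 y"
  have "R \<noteq> 0"
  proof
    assume "R = 0"
    then have "(norm (y i))\<^sup>2 \<le> 0" if "i \<in> {1..N}" for i
      using norm_power_le_rademacher_moment[OF that, of y 2] unfolding R_def by simp
    then have "(\<Sum>i\<in>{1..N}. (norm (y i))\<^sup>2) \<le> 0"
      by (intro sum_nonpos) auto
    then show False
      using y \<open>R = 0\<close> unfolding R_def by simp
  qed
  then have R: "0 < R"
    using rademacher_moment_nonneg[of N "{1..N}" 2 y] unfolding R_def by simp
  define x where "x i = (1 / sqrt R) *\<^sub>R y i" for i
  have xsum: "(\<Sum>i\<in>{1..N}. \<epsilon> i *\<^sub>R x i) = (1 / sqrt R) *\<^sub>R (\<Sum>i\<in>{1..N}. \<epsilon> i *\<^sub>R y i)" for \<epsilon> :: "nat \<Rightarrow> real"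
    unfolding x_def scaleR_right.sum by (simp add: mult.commute)
  have sq: "(norm ((1 / sqrt R) *\<^sub>R v))\<^sup>2 = (norm v)\<^sup>2 / R" for v :: 'a
    using R by (simp add: power_divide)
  have "(\<Sum>\<epsilon>\<in>hypercube N. (norm (\<Sum>i\<in>{1..N}. \<epsilon> i *\<^sub>R y i))\<^sup>2) = 2 ^ N * R"
    by (simp add: R_def rademacher_moment_def)
  then have x1: "rademacher_moment N {1..N} 2 x = 1"
    using R unfolding rademacher_moment_def xsum sq sum_divide_distrib[symmetric] by simp
  have xbig: "N * (1 - \<kappa>) < (\<Sum>i\<in>{1..N}. (norm (x i))\<^sup>2)"
    using y R unfolding x_def sq sum_divide_distrib[symmetric] R_def[symmetric]
    by (simp add: field_simps)
  have xle: "(norm (x i))\<^sup>2 \<le> 1" if "i \<in> {1..N}" for i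
    using norm_power_le_rademacher_moment[OF that, of x 2] x1 by simp
  \<comment> \<open>The other \<open>N - 1\<close> squared norms are at most \<open>1\<close>, and all \<open>N\<close> of them add up to more than \<open>N * (1 - \<kappa>)\<close>.\<close>
  have xge: "1 - N * \<kappa> \<le> norm (x i)" if i: "i \<in> {1..N}" for i
  proof -
    have "(\<Sum>j\<in>{1..N} - {i}. (norm (x j))\<^sup>2) \<le> of_nat (card ({1..N} - {i})) * 1"
      using xle by (intro sum_bounded_above) auto
    moreover have "(\<Sum>j\<in>{1..N}. (norm (x j))\<^sup>2) = (norm (x i))\<^sup>2 + (\<Sum>j\<in>{1..N} - {i}. (norm (x j))\<^sup>2)"
      using i by (simp add: sum.remove)
    ultimately have "1 - N * \<kappa> \<le> (norm (x i))\<^sup>2"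
      using xbig i N by (simp add: algebra_simps of_nat_diff)
    also have "\<dots> \<le> norm (x i)"
      using xle[OF i] power2_le_imp_le[of "norm (x i)" 1] by (simp add: power2_eq_square mult_left_le)
    finally show ?thesis .
  qed
  have small: "norm (\<Sum>i\<in>{1..N}. \<epsilon> i *\<^sub>R x i) \<le> 1 + \<tau>" if \<epsilon>: "\<epsilon> \<in> hypercube N" for \<epsilon>
  proof -
    define S where "S \<epsilon> = norm (\<Sum>i\<in>{1..N}. \<epsilon> i *\<^sub>R x i)" for \<epsilon> :: "nat \<Rightarrow> real"
    have S2: "(\<Sum>\<epsilon>\<in>hypercube N. (S \<epsilon>)\<^sup>2) = 2 ^ N"
      using x1 unfolding rademacher_moment_def S_def by simp
    have "1 - N * \<kappa> \<le> rademacher_moment N {1..N} 1 x"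
      using xge[of 1] norm_power_le_rademacher_moment[of 1 N x 1] N by simp
    then have S1: "2 ^ N * (1 - N * \<kappa>) \<le> (\<Sum>\<epsilon>\<in>hypercube N. S \<epsilon>)"
      unfolding rademacher_moment_def S_def by (simp add: field_simps)
    have "(S \<epsilon> - 1)\<^sup>2 \<le> (\<Sum>\<epsilon>\<in>hypercube N. (S \<epsilon> - 1)\<^sup>2)"
      using \<epsilon> by (intro member_le_sum) auto
    also have "\<dots> = (\<Sum>\<epsilon>\<in>hypercube N. (S \<epsilon>)\<^sup>2) - 2 * (\<Sum>\<epsilon>\<in>hypercube N. S \<epsilon>) + 2 ^ N"
      by (simp add: power2_diff sum.distrib sum_subtractf sum_distrib_left card_hypercube)
    also have "\<dots> \<le> 2 ^ (N + 1) * (N * \<kappa>)"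
      using S1 S2 by (simp add: algebra_simps)
    also have "\<dots> = \<tau>\<^sup>2"
      unfolding \<kappa>N by simp
    finally have "\<bar>S \<epsilon> - 1\<bar> \<le> \<bar>\<tau>\<bar>"
      by (simp add: abs_le_square_iff)
    then show ?thesis
      using \<tau> unfolding S_def by simp
  qed
  show thesis
    using that[of x] xge small \<kappa>\<tau> by (meson diff_left_mono order_trans)
qed

text \<open>
  The norm is convex, so on a box it is largest at a vertex. The translation \<open>v\<close> lets the induction
  deal with one coordinate at a time.
\<close>

lemma norm_sum_le_of_sign_sums:
  fixes x :: "'i \<Rightarrow> 'a::real_normed_vector"
  assumes "finite I"
    and "\<And>\<epsilon> :: 'i \<Rightarrow> real. (\<And>i. i \<in> I \<Longrightarrow> \<epsilon> i \<in> {-1, 1}) \<Longrightarrow> norm (v + (\<Sum>i\<in>I. \<epsilon> i *\<^sub>R x i)) \<le> c"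
    and "\<And>i. i \<in> I \<Longrightarrow> \<bar>a i\<bar> \<le> 1"
  shows "norm (v + (\<Sum>i\<in>I. a i *\<^sub>R x i)) \<le> c"
  using assms
proof (induction I arbitrary: v rule: finite_induct)
  case empty
  then show ?case by simp
next
  case (insert k I)
  define u where "u = (\<Sum>i\<in>I. a i *\<^sub>R x i)"
  have IH: "norm ((v + s *\<^sub>R x k) + u) \<le> c" if s: "s \<in> {-1, 1}" for s
    unfolding u_def
  proof (rule insert.IH)
    fix \<epsilon> :: "'i \<Rightarrow> real"
    assume \<epsilon>: "\<And>i. i \<in> I \<Longrightarrow> \<epsilon> i \<in> {-1, 1}"
    have "(\<Sum>i\<in>I. (\<epsilon>(k := s)) i *\<^sub>R x i) = (\<Sum>i\<in>I. \<epsilon> i *\<^sub>R x i)"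
      using insert.hyps by (intro sum.cong) auto
    moreover have "norm (v + (\<Sum>i\<in>insert k I. (\<epsilon>(k := s)) i *\<^sub>R x i)) \<le> c"
      using \<epsilon> s by (intro insert.prems(1)) auto
    ultimately show "norm (v + s *\<^sub>R x k + (\<Sum>i\<in>I. \<epsilon> i *\<^sub>R x i)) \<le> c"
      using insert.hyps by (simp add: add.assoc)
  qed (use insert.prems in auto)
  have a: "\<bar>a k\<bar> \<le> 1"
    using insert.prems by auto
  have "v + (\<Sum>i\<in>insert k I. a i *\<^sub>R x i) =
      ((1 + a k) / 2) *\<^sub>R (v + 1 *\<^sub>R x k + u) + ((1 - a k) / 2) *\<^sub>R (v + (-1) *\<^sub>R x k + u)"
  proof -
    have "((1 + a k) / 2) *\<^sub>R (v + 1 *\<^sub>R x k + u) + ((1 - a k) / 2) *\<^sub>R (v + (-1) *\<^sub>R x k + u) =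
        ((1 + a k) / 2 + (1 - a k) / 2) *\<^sub>R (v + u) + ((1 + a k) / 2 - (1 - a k) / 2) *\<^sub>R x k"
      by (simp only: scaleR_add_left scaleR_add_right scaleR_diff_left scaleR_one scaleR_minus1_left
          scaleR_minus_left scaleR_minus_right diff_conv_add_uminus add_ac)
    also have "(1 + a k) / 2 + (1 - a k) / 2 = 1"
      by (simp add: field_simps)
    also have "(1 + a k) / 2 - (1 - a k) / 2 = a k"
      by (simp add: field_simps)
    finally show ?thesis
      using insert.hyps by (simp add: u_def add_ac)
  qed
  also have "norm \<dots> \<le> norm (((1 + a k) / 2) *\<^sub>R (v + 1 *\<^sub>R x k + u))
      + norm (((1 - a k) / 2) *\<^sub>R (v + (-1) *\<^sub>R x k + u))"
    by (rule norm_triangle_ineq)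
  also have "\<dots> \<le> (1 + a k) / 2 * c + (1 - a k) / 2 * c"
    unfolding norm_scaleR using a IH[of 1] IH[of "-1"]
    by (intro add_mono mult_mono) auto
  also have "\<dots> = c"
    by (simp add: field_simps)
  finally show ?case .
qed

lemma norm_sum_le_of_hypercube:
  fixes x :: "nat \<Rightarrow> 'a::real_normed_vector"
  assumes sgn: "\<And>\<epsilon>. \<epsilon> \<in> hypercube N \<Longrightarrow> norm (\<Sum>i\<in>{1..N}. \<epsilon> i *\<^sub>R x i) \<le> c"
    and a: "\<And>i. i \<in> {1..N} \<Longrightarrow> \<bar>a i\<bar> \<le> b"
    and b: "0 \<le> b"
  shows "norm (\<Sum>i\<in>{1..N}. a i *\<^sub>R x i) \<le> b * c"
proof (cases "b = 0")
  case True
  then show ?thesis using a by simp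
next
  case False
  with b have b0: "0 < b" by simp
  have "norm (0 + (\<Sum>i\<in>{1..N}. (a i / b) *\<^sub>R x i)) \<le> c"
  proof (rule norm_sum_le_of_sign_sums)
    fix \<epsilon> :: "nat \<Rightarrow> real"
    assume \<epsilon>: "\<And>i. i \<in> {1..N} \<Longrightarrow> \<epsilon> i \<in> {-1, 1}"
    have "restrict \<epsilon> {1..N} \<in> hypercube N"
      unfolding hypercube_def using \<epsilon> by (intro restrict_PiE_iff[THEN iffD2]) auto
    moreover have "(\<Sum>i\<in>{1..N}. restrict \<epsilon> {1..N} i *\<^sub>R x i) = (\<Sum>i\<in>{1..N}. \<epsilon> i *\<^sub>R x i)"
      by (intro sum.cong) auto
    ultimately show "norm (0 + (\<Sum>i\<in>{1..N}. \<epsilon> i *\<^sub>R x i)) \<le> c"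
      using sgn[of "restrict \<epsilon> {1..N}"] by simp
  qed (use a b0 in auto)
  moreover have "(\<Sum>i\<in>{1..N}. a i *\<^sub>R x i) = b *\<^sub>R (\<Sum>i\<in>{1..N}. (a i / b) *\<^sub>R x i)"
    using b0 by (simp add: scaleR_right.sum)
  ultimately show ?thesis
    using b0 by simp
qed

text \<open>
  Let \<open>a k\<close> be the coefficient of largest modulus. Changing the sign of all other coefficients gives a
  second sum of norm at most \<open>\<bar>a k\<bar> * c\<close>, while the two sums add up to \<open>(2 * a k) *\<^sub>R x k\<close>. So an
  upper bound for the signed sums that is close to the norms of the vectors forces a lower bound.
\<close>

lemma norm_sum_ge_of_hypercube:
  fixes x :: "nat \<Rightarrow> 'a::real_normed_vector"
  assumes sgn: "\<And>\<epsilon>. \<epsilon> \<in> hypercube N \<Longrightarrow> norm (\<Sum>i\<in>{1..N}. \<epsilon> i *\<^sub>R x i) \<le> c"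
    and x: "\<And>i. i \<in> {1..N} \<Longrightarrow> l \<le> norm (x i)"
    and c: "c \<le> 2 * l"
    and j: "j \<in> {1..N}"
  shows "\<bar>a j\<bar> * (2 * l - c) \<le> norm (\<Sum>i\<in>{1..N}. a i *\<^sub>R x i)"
proof -
  define b where "b = Max ((\<lambda>i. \<bar>a i\<bar>) ` {1..N})"
  have "b \<in> (\<lambda>i. \<bar>a i\<bar>) ` {1..N}"
    unfolding b_def using j by (intro Max_in) auto
  then obtain k where k: "k \<in> {1..N}" "b = \<bar>a k\<bar>" by auto
  have ab: "\<bar>a i\<bar> \<le> b" if "i \<in> {1..N}" for i
    unfolding b_def using that by (intro Max_ge) auto
  define a' where "a' i = (if i = k then a k else - a i)" for i
  have "norm (\<Sum>i\<in>{1..N}. a' i *\<^sub>R x i) \<le> b * c"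
    by (rule norm_sum_le_of_hypercube[OF sgn]) (use ab k in \<open>auto simp: a'_def\<close>)
  moreover have "(\<Sum>i\<in>{1..N}. a i *\<^sub>R x i) + (\<Sum>i\<in>{1..N}. a' i *\<^sub>R x i) = (2 * a k) *\<^sub>R x k"
  proof -
    have "(\<Sum>i\<in>{1..N}. a i *\<^sub>R x i) + (\<Sum>i\<in>{1..N}. a' i *\<^sub>R x i) =
        (\<Sum>i\<in>{1..N}. if i = k then (2 * a k) *\<^sub>R x k else 0)"
      unfolding sum.distrib[symmetric]
      by (intro sum.cong refl) (auto simp: a'_def simp flip: scaleR_add_left)
    then show ?thesis using k by simp
  qed
  moreover have "2 * b * l \<le> norm ((2 * a k) *\<^sub>R x k)"
    using k x[OF k(1)] by (simp add: abs_mult mult_left_mono)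
  ultimately have "b * (2 * l - c) \<le> norm (\<Sum>i\<in>{1..N}. a i *\<^sub>R x i)"
    using norm_triangle_ineq[of "\<Sum>i\<in>{1..N}. a i *\<^sub>R x i" "\<Sum>i\<in>{1..N}. a' i *\<^sub>R x i"]
    by (simp add: algebra_simps)
  moreover have "\<bar>a j\<bar> * (2 * l - c) \<le> b * (2 * l - c)"
    using ab[OF j] c by (intro mult_right_mono) auto
  ultimately show ?thesis by simp
qed

section \<open>Chebyshev polynomials at the right endpoint\<close>

fun chebyshev :: "nat \<Rightarrow> real \<Rightarrow> real" where
  "chebyshev 0 t = 1"
| "chebyshev (Suc 0) t = t"
| "chebyshev (Suc (Suc k)) t = 2 * t * chebyshev (Suc k) t - chebyshev k t"

lemma chebyshev_cos: "chebyshev k (cos t) = cos (real k * t)"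
proof (induction k "cos t" rule: chebyshev.induct)
  case (3 k)
  have "cos (real (Suc (Suc k)) * t) + cos (real k * t) = 2 * cos t * cos (real (Suc k) * t)"
  proof -
    have e: "real (Suc (Suc k)) * t = real (Suc k) * t + t" "real k * t = real (Suc k) * t - t"
      by (simp_all add: algebra_simps)
    show ?thesis
      unfolding e cos_add cos_diff by simp
  qed
  then show ?case
    using 3 by simp
qed simp_all

lemma abs_chebyshev_le_1: "\<bar>t\<bar> \<le> 1 \<Longrightarrow> \<bar>chebyshev k t\<bar> \<le> 1"
  using chebyshev_cos[of k "arccos t"] by (simp add: cos_arccos_abs)

lemma chebyshev_at_1: "chebyshev k 1 = 1"
  using chebyshev_cos[of k 0] by simp

lemma chebyshev_deriv_at_1: "(chebyshev k has_real_derivative (real k)\<^sup>2) (at 1)"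
proof (induction k rule: induct_nat_012)
  case 0
  have "chebyshev 0 = (\<lambda>t. 1)" by auto
  then show ?case by simp
next
  case 1
  have "chebyshev (Suc 0) = (\<lambda>t. t)" by auto
  then show ?case by simp
next
  case (ge2 k)
  have e: "chebyshev (Suc (Suc k)) = (\<lambda>t. 2 * t * chebyshev (Suc k) t - chebyshev k t)"
    by auto
  show ?case
    unfolding e
    by (rule derivative_eq_intros ge2 refl)+
      (simp add: chebyshev_at_1 power2_eq_square algebra_simps)
qed

text \<open>
  The left side is the difference quotient of the Chebyshev polynomial at \<open>1\<close> with step \<open>-2 / n\<close>.
\<close>

lemma chebyshev_laplacian_limit:
  "(\<lambda>n. real n / 2 * (1 - chebyshev d (1 - 2 / real n))) \<longlonglongrightarrow> (real d)\<^sup>2"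
proof -
  have lim: "((\<lambda>h. (chebyshev d (1 + h) - chebyshev d 1) / h) \<longlongrightarrow> (real d)\<^sup>2) (at 0)"
    using chebyshev_deriv_at_1[of d] by (simp add: DERIV_def)
  have "filterlim (\<lambda>n. - 2 / real n) (at 0) sequentially"
    unfolding filterlim_at
  proof
    show "\<forall>\<^sub>F n in sequentially. - 2 / real n \<in> UNIV \<and> - 2 / real n \<noteq> 0"
      using eventually_gt_at_top[of 0] by eventually_elim simp
    show "((\<lambda>n. - 2 / real n) \<longlongrightarrow> 0) sequentially"
      by (rule lim_const_over_n)
  qed
  from filterlim_compose[OF lim this] have
    "(\<lambda>n. (chebyshev d (1 + - 2 / real n) - chebyshev d 1) / (- 2 / real n)) \<longlonglongrightarrow> (real d)\<^sup>2" .
  then show ?thesis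
    by (rule Lim_transform_eventually)
       (use eventually_gt_at_top[of 0] in \<open>eventually_elim, simp add: chebyshev_at_1 field_simps\<close>)
qed

section \<open>Degree and Laplacian on the cube\<close>

lemma walsh_multiply_signs:
  assumes "A \<subseteq> {1..n}"
  shows "walsh A (multiply_signs n \<sigma> \<epsilon>) = walsh A \<sigma> * walsh A \<epsilon>"
proof -
  have "walsh A (multiply_signs n \<sigma> \<epsilon>) = (\<Prod>i\<in>A. \<sigma> i * \<epsilon> i)"
    unfolding walsh_def multiply_signs_def using assms by (intro prod.cong) auto
  then show ?thesis
    by (simp add: walsh_def prod.distrib)
qed

lemma sum_walsh_eq_0:
  assumes A: "A \<subseteq> {1..n}" and i: "i \<in> A"
  shows "(\<Sum>\<epsilon>\<in>hypercube n. walsh A \<epsilon>) = 0"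
proof -
  define \<sigma> :: "nat \<Rightarrow> real" where "\<sigma> j = (if j = i then -1 else 1)" for j
  have fin: "finite A"
    using A finite_subset by blast
  have "walsh A \<sigma> = (\<Prod>j\<in>A. if j = i then -1 else 1)"
    unfolding walsh_def \<sigma>_def ..
  then have "walsh A \<sigma> = -1"
    using i fin by (simp add: prod.delta)
  moreover have "(\<Sum>\<epsilon>\<in>hypercube n. walsh A \<epsilon>) = (\<Sum>\<epsilon>\<in>hypercube n. walsh A (multiply_signs n \<sigma> \<epsilon>))"
    by (rule sum.reindex_bij_betw[OF bij_betw_multiply_signs, symmetric]) (simp add: \<sigma>_def)
  ultimately show ?thesis
    by (simp add: walsh_multiply_signs[OF A] sum_negf)
qed

lemma walsh_mult_coord:
  assumes "A \<subseteq> {1..n}" "i \<in> {1..n}" "\<epsilon> \<in> hypercube n"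
  shows "walsh A \<epsilon> * \<epsilon> i = walsh (if i \<in> A then A - {i} else insert i A) \<epsilon>"
proof -
  have fin: "finite A"
    using assms(1) finite_subset by blast
  have "\<epsilon> i * \<epsilon> i = 1"
    using hypercube_coord[OF assms(3,2)] by auto
  then show ?thesis
    using fin by (cases "i \<in> A") (auto simp: walsh_def prod.remove[of A i])
qed

lemma cube_degree_le_const: "cube_degree_le n (\<lambda>_. x) 0"
  unfolding cube_degree_le_def
proof (intro allI impI)
  fix A assume A: "A \<subseteq> {1..n}" "0 < card A"
  then obtain i where "i \<in> A"
    by (auto simp: card_gt_0_iff)
  then show "fourier_coeff n (\<lambda>_. x) A = 0"
    using sum_walsh_eq_0[OF A(1)] unfolding fourier_coeff_def by (simp flip: scaleR_left.sum)
qed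

lemma cube_degree_le_mono: "cube_degree_le n f k \<Longrightarrow> k \<le> l \<Longrightarrow> cube_degree_le n f l"
  unfolding cube_degree_le_def by auto

lemma cube_degree_le_scaleR: "cube_degree_le n f k \<Longrightarrow> cube_degree_le n (\<lambda>\<epsilon>. c *\<^sub>R f \<epsilon>) k"
proof -
  have "fourier_coeff n (\<lambda>\<epsilon>. c *\<^sub>R f \<epsilon>) A = c *\<^sub>R fourier_coeff n f A" for A
    unfolding fourier_coeff_def by (simp add: scaleR_right.sum mult_ac)
  then show "cube_degree_le n f k \<Longrightarrow> ?thesis"
    unfolding cube_degree_le_def by simp
qed

lemma cube_degree_le_diff:
  "cube_degree_le n f k \<Longrightarrow> cube_degree_le n g k \<Longrightarrow> cube_degree_le n (\<lambda>\<epsilon>. f \<epsilon> - g \<epsilon>) k"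
proof -
  have "fourier_coeff n (\<lambda>\<epsilon>. f \<epsilon> - g \<epsilon>) A = fourier_coeff n f A - fourier_coeff n g A" for A
    unfolding fourier_coeff_def by (simp add: scaleR_diff_right sum_subtractf)
  then show "cube_degree_le n f k \<Longrightarrow> cube_degree_le n g k \<Longrightarrow> ?thesis"
    unfolding cube_degree_le_def by simp
qed

lemma cube_degree_le_sum:
  "(\<And>j. j \<in> J \<Longrightarrow> cube_degree_le n (f j) k) \<Longrightarrow> cube_degree_le n (\<lambda>\<epsilon>. \<Sum>j\<in>J. f j \<epsilon>) k"
proof -
  have "fourier_coeff n (\<lambda>\<epsilon>. \<Sum>j\<in>J. f j \<epsilon>) A = (\<Sum>j\<in>J. fourier_coeff n (f j) A)" for A
    unfolding fourier_coeff_def scaleR_right.sum by (rule sum.swap)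
  then show "(\<And>j. j \<in> J \<Longrightarrow> cube_degree_le n (f j) k) \<Longrightarrow> ?thesis"
    unfolding cube_degree_le_def by simp
qed

text \<open>
  Multiplication by a coordinate \<open>i\<close> permutes the Walsh functions, taking \<open>A\<close> to its symmetric
  difference with \<open>{i}\<close>, so it moves the Fourier support by at most one level. With the three-term recurrence
  this gives the degree of Chebyshev polynomials of a linear form.
\<close>

lemma cube_degree_le_mult_coord:
  assumes f: "cube_degree_le n f k" and i: "i \<in> {1..n}"
  shows "cube_degree_le n (\<lambda>\<epsilon>. \<epsilon> i *\<^sub>R f \<epsilon>) (Suc k)"
  unfolding cube_degree_le_def
proof (intro allI impI)
  fix A assume A: "A \<subseteq> {1..n}" "Suc k < card A"
  define A' where "A' = (if i \<in> A then A - {i} else insert i A)"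
  have "finite A"
    using A finite_subset by blast
  then have "A' \<subseteq> {1..n}" "k < card A'"
    using A i by (auto simp: A'_def)
  then have "fourier_coeff n f A' = 0"
    using f unfolding cube_degree_le_def by blast
  then show "fourier_coeff n (\<lambda>\<epsilon>. \<epsilon> i *\<^sub>R f \<epsilon>) A = 0"
    unfolding fourier_coeff_def A'_def
    by (simp add: walsh_mult_coord[OF A(1) i] del: scaleR_eq_0_iff)
qed

text \<open>
  This is the normalised inner product of \<open>\<delta>\<close> and \<open>\<epsilon>\<close>: it equals \<open>1\<close> at \<open>\<epsilon> = \<delta>\<close> and
  falls by \<open>2 / n\<close> with each flipped sign.
\<close>

definition coord_mean :: "nat \<Rightarrow> (nat \<Rightarrow> real) \<Rightarrow> (nat \<Rightarrow> real) \<Rightarrow> real" where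
  "coord_mean n \<delta> \<epsilon> = (\<Sum>i\<in>{1..n}. \<epsilon> i * \<delta> i) / n"

lemma cube_degree_le_chebyshev:
  "cube_degree_le n (\<lambda>\<epsilon>. chebyshev k (coord_mean n \<delta> \<epsilon>) *\<^sub>R x) k"
proof -
  have mult: "cube_degree_le n (\<lambda>\<epsilon>. coord_mean n \<delta> \<epsilon> *\<^sub>R f \<epsilon>) (Suc l)"
    if "cube_degree_le n f l" for f :: "(nat \<Rightarrow> real) \<Rightarrow> 'a" and l
  proof -
    have "cube_degree_le n (\<lambda>\<epsilon>. \<Sum>i\<in>{1..n}. (\<delta> i / n) *\<^sub>R \<epsilon> i *\<^sub>R f \<epsilon>) (Suc l)"
      by (intro cube_degree_le_sum cube_degree_le_scaleR cube_degree_le_mult_coord that)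
    then show ?thesis
      by (simp add: coord_mean_def scaleR_left.sum sum_divide_distrib mult.commute)
  qed
  show ?thesis
  proof (induction k rule: induct_nat_012)
    case 0
    then show ?case using cube_degree_le_const by simp
  next
    case 1
    then show ?case using mult[OF cube_degree_le_const[of n x]] by simp
  next
    case (ge2 k)
    have "cube_degree_le n (\<lambda>\<epsilon>. 2 *\<^sub>R (coord_mean n \<delta> \<epsilon> *\<^sub>R (chebyshev (Suc k) (coord_mean n \<delta> \<epsilon>) *\<^sub>R x))
        - chebyshev k (coord_mean n \<delta> \<epsilon>) *\<^sub>R x) (Suc (Suc k))"
      by (intro cube_degree_le_diff cube_degree_le_scaleR mult ge2 cube_degree_le_mono[OF ge2(1)]) simp
    then show ?case
      by (simp add: scaleR_diff_left mult_ac)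
  qed
qed

text \<open>
  For \<open>\<eta> = \<epsilon> \<delta>\<close> the left side is \<open>2 ^ n\<close> times the kernel of the Laplacian. It is the derivative at
  \<open>t = 1\<close> of \<open>(\<Prod>j\<in>I. 1 + t * \<eta> j)\<close>. On the right, each product vanishes unless \<open>\<eta> j = 1\<close> for all
  \<open>j \<noteq> i\<close>, that is, unless \<open>\<delta>\<close> is \<open>\<epsilon>\<close> or its neighbour in direction \<open>i\<close>.
\<close>

lemma sum_card_walsh:
  assumes "finite I"
  shows "(\<Sum>A\<in>Pow I. real (card A) * walsh A \<eta>) =
    (\<Sum>i\<in>I. \<eta> i * (\<Prod>j\<in>I - {i}. 1 + \<eta> j))"
  using assms
proof (induction I rule: finite_induct)
  case empty
  then show ?case by simp
next
  case (insert a I)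
  have fin: "finite A" "a \<notin> A" if "A \<in> Pow I" for A
    using that insert.hyps finite_subset by auto
  have inj: "inj_on (insert a) (Pow I)"
    using insert.hyps(2) by (intro inj_onI) (auto simp: insert_ident)
  have "(\<Sum>A\<in>insert a ` Pow I. real (card A) * walsh A \<eta>) =
      (\<Sum>A\<in>Pow I. \<eta> a * (real (card A) * walsh A \<eta>) + \<eta> a * walsh A \<eta>)"
    unfolding sum.reindex[OF inj] o_def
    by (intro sum.cong refl) (use fin in \<open>auto simp: walsh_def algebra_simps\<close>)
  also have "\<dots> = \<eta> a * (\<Sum>A\<in>Pow I. real (card A) * walsh A \<eta>) + \<eta> a * (\<Prod>j\<in>I. 1 + \<eta> j)"
    using prod_add[OF insert.hyps(1), of \<eta> "\<lambda>_. 1"]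
    by (simp add: sum.distrib walsh_def add.commute flip: sum_distrib_left)
  finally have "(\<Sum>A\<in>Pow (insert a I). real (card A) * walsh A \<eta>) =
      (1 + \<eta> a) * (\<Sum>A\<in>Pow I. real (card A) * walsh A \<eta>) + \<eta> a * (\<Prod>j\<in>I. 1 + \<eta> j)"
    unfolding Pow_insert using insert.hyps
    by (subst sum.union_disjoint) (auto simp: algebra_simps)
  also have "(1 + \<eta> a) * (\<Sum>A\<in>Pow I. real (card A) * walsh A \<eta>) =
      (\<Sum>i\<in>I. \<eta> i * (\<Prod>j\<in>insert a I - {i}. 1 + \<eta> j))"
    unfolding insert.IH sum_distrib_left
  proof (intro sum.cong refl)
    fix i assume "i \<in> I"
    then have "insert a I - {i} = insert a (I - {i})" "a \<notin> I - {i}"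
      using insert.hyps by auto
    then show "(1 + \<eta> a) * (\<eta> i * (\<Prod>j\<in>I - {i}. 1 + \<eta> j)) = \<eta> i * (\<Prod>j\<in>insert a I - {i}. 1 + \<eta> j)"
      using insert.hyps by simp
  qed
  finally show ?case
    using insert.hyps by (simp add: add.commute)
qed

lemma sum_flip_kernel:
  fixes f :: "(nat \<Rightarrow> real) \<Rightarrow> 'a::real_vector"
  assumes \<epsilon>: "\<epsilon> \<in> hypercube n" and i: "i \<in> {1..n}"
  shows "(\<Sum>\<delta>\<in>hypercube n. (\<epsilon> i * \<delta> i * (\<Prod>j\<in>{1..n} - {i}. 1 + \<epsilon> j * \<delta> j)) *\<^sub>R f \<delta>) =
    2 ^ (n - 1) *\<^sub>R (f \<epsilon> - f (\<epsilon>(i := - \<epsilon> i)))"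
proof -
  define \<epsilon>' where "\<epsilon>' = \<epsilon>(i := - \<epsilon> i)"
  have sq: "\<epsilon> j * \<epsilon> j = 1" if "j \<in> {1..n}" for j
    using hypercube_coord[OF \<epsilon> that] by auto
  have ne: "\<epsilon> \<noteq> \<epsilon>'"
    using sq[OF i] unfolding \<epsilon>'_def by (auto simp: fun_eq_iff)
  have \<epsilon>': "\<epsilon>' \<in> hypercube n"
    using \<epsilon> i unfolding hypercube_def \<epsilon>'_def by (auto simp: PiE_iff extensional_def)
  have zero: "(\<Prod>j\<in>{1..n} - {i}. 1 + \<epsilon> j * \<delta> j) = 0"
    if \<delta>: "\<delta> \<in> hypercube n" "\<delta> \<noteq> \<epsilon>" "\<delta> \<noteq> \<epsilon>'" for \<delta>
  proof (rule ccontr)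
    assume nz: "(\<Prod>j\<in>{1..n} - {i}. 1 + \<epsilon> j * \<delta> j) \<noteq> 0"
    have agree: "\<delta> j = \<epsilon> j" if "j \<noteq> i" for j
    proof (cases "j \<in> {1..n}")
      case True
      then have "1 + \<epsilon> j * \<delta> j \<noteq> 0"
        using nz that by (auto simp: prod_zero_iff)
      then show ?thesis
        using hypercube_coord[OF \<delta>(1) True] hypercube_coord[OF \<epsilon> True] by auto
    next
      case False
      then show ?thesis
        using \<delta>(1) \<epsilon> unfolding hypercube_def by (auto simp: PiE_iff extensional_def)
    qed
    have "\<delta> i = \<epsilon> i \<or> \<delta> i = - \<epsilon> i"
      using hypercube_coord[OF \<delta>(1) i] hypercube_coord[OF \<epsilon> i] by auto
    then have "(\<forall>j. \<delta> j = \<epsilon> j) \<or> (\<forall>j. \<delta> j = \<epsilon>' j)"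
      using agree unfolding \<epsilon>'_def by (metis fun_upd_apply)
    then show False
      using \<delta>(2,3) by (simp flip: fun_eq_iff)
  qed
  have prod2: "(\<Prod>j\<in>{1..n} - {i}. 1 + \<epsilon> j * \<epsilon> j) = 2 ^ (n - 1)"
    "(\<Prod>j\<in>{1..n} - {i}. 1 + \<epsilon> j * \<epsilon>' j) = 2 ^ (n - 1)"
    using sq i by (simp_all add: \<epsilon>'_def)
  have "(\<Sum>\<delta>\<in>hypercube n. (\<epsilon> i * \<delta> i * (\<Prod>j\<in>{1..n} - {i}. 1 + \<epsilon> j * \<delta> j)) *\<^sub>R f \<delta>) =
      (\<Sum>\<delta>\<in>{\<epsilon>, \<epsilon>'}. (\<epsilon> i * \<delta> i * (\<Prod>j\<in>{1..n} - {i}. 1 + \<epsilon> j * \<delta> j)) *\<^sub>R f \<delta>)"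
    using \<epsilon> \<epsilon>' zero by (intro sum.mono_neutral_right) auto
  also have "\<dots> = (\<epsilon> i * \<epsilon> i * 2 ^ (n - 1)) *\<^sub>R f \<epsilon> + (\<epsilon> i * \<epsilon>' i * 2 ^ (n - 1)) *\<^sub>R f \<epsilon>'"
    using ne by (simp only: prod2 sum.insert finite.emptyI finite_insert empty_iff
        insert_iff sum.empty add_0_right simp_thms)
  also have "\<dots> = 2 ^ (n - 1) *\<^sub>R (f \<epsilon> - f \<epsilon>')"
    using sq[OF i] by (simp add: \<epsilon>'_def scaleR_diff_right)
  finally show ?thesis
    unfolding \<epsilon>'_def .
qed

text \<open>
  The spectral Laplacian is the graph Laplacian of the cube. The combinatorial form gives its
  value at a point without any Fourier coefficient being computed.
\<close>

lemma cube_laplacian_eq_sum_differences: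
  fixes f :: "(nat \<Rightarrow> real) \<Rightarrow> 'a::real_vector"
  assumes \<epsilon>: "\<epsilon> \<in> hypercube n"
  shows "cube_laplacian n f \<epsilon> = (\<Sum>i\<in>{1..n}. (1 / 2) *\<^sub>R (f \<epsilon> - f (\<epsilon>(i := - \<epsilon> i))))"
proof -
  have "cube_laplacian n f \<epsilon> = (1 / 2 ^ n) *\<^sub>R (\<Sum>A\<in>Pow {1..n}. \<Sum>\<delta>\<in>hypercube n.
      (real (card A) * walsh A (\<lambda>i. \<epsilon> i * \<delta> i)) *\<^sub>R f \<delta>)"
    unfolding cube_laplacian_def fourier_coeff_def
    by (simp add: scaleR_right.sum walsh_def prod.distrib mult_ac)
  also have "\<dots> = (1 / 2 ^ n) *\<^sub>R (\<Sum>\<delta>\<in>hypercube n.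
      (\<Sum>A\<in>Pow {1..n}. real (card A) * walsh A (\<lambda>i. \<epsilon> i * \<delta> i)) *\<^sub>R f \<delta>)"
    by (subst sum.swap) (simp add: scaleR_left.sum)
  also have "\<dots> = (1 / 2 ^ n) *\<^sub>R (\<Sum>i\<in>{1..n}. \<Sum>\<delta>\<in>hypercube n.
      (\<epsilon> i * \<delta> i * (\<Prod>j\<in>{1..n} - {i}. 1 + \<epsilon> j * \<delta> j)) *\<^sub>R f \<delta>)"
    by (subst sum.swap) (simp add: sum_card_walsh scaleR_left.sum)
  also have "\<dots> = (1 / 2 ^ n) *\<^sub>R (\<Sum>i\<in>{1..n}. 2 ^ (n - 1) *\<^sub>R (f \<epsilon> - f (\<epsilon>(i := - \<epsilon> i))))"
    by (simp only: sum_flip_kernel[OF \<epsilon>] cong: sum.cong)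
  also have "\<dots> = (\<Sum>i\<in>{1..n}. (1 / 2) *\<^sub>R (f \<epsilon> - f (\<epsilon>(i := - \<epsilon> i))))"
    unfolding scaleR_right.sum
  proof (intro sum.cong refl)
    fix i assume "i \<in> {1..n}"
    then have "(2::real) ^ n = 2 * 2 ^ (n - 1)"
      by (cases n) auto
    then show "(1 / 2 ^ n) *\<^sub>R 2 ^ (n - 1) *\<^sub>R (f \<epsilon> - f (\<epsilon>(i := - \<epsilon> i))) =
        (1 / 2) *\<^sub>R (f \<epsilon> - f (\<epsilon>(i := - \<epsilon> i)))"
      by simp
  qed
  finally show ?thesis .
qed

section \<open>Norms on the cube\<close>

lemma cube_Lp_norm_const:
  assumes "1 \<le> p" "0 \<le> u" "\<And>\<epsilon>. \<epsilon> \<in> hypercube n \<Longrightarrow> norm (f \<epsilon>) = u"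
  shows "cube_Lp_norm n p f = u"
proof (cases "p = \<infinity>")
  case True
  have "(\<lambda>\<epsilon>. norm (f \<epsilon>)) ` hypercube n = {u}"
    using assms(3) hypercube_nonempty[of n] by (auto simp: image_iff ex_in_conv)
  then show ?thesis
    using True by (simp add: cube_Lp_norm_def)
next
  case False
  with assms(1) obtain r where r: "p = ereal r" "1 \<le> r"
    by (cases p) auto
  have "(\<Sum>\<epsilon>\<in>hypercube n. norm (f \<epsilon>) powr r) = (\<Sum>\<epsilon>\<in>hypercube n. u powr r)"
    using assms(3) by (intro sum.cong) auto
  then show ?thesis
    using r assms(2) by (simp add: cube_Lp_norm_def card_hypercube powr_powr)
qed

lemma cube_Lp_norm_mono:
  assumes "1 \<le> p" "\<And>\<epsilon>. \<epsilon> \<in> hypercube n \<Longrightarrow> norm (f \<epsilon>) \<le> norm (g \<epsilon>)"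
  shows "cube_Lp_norm n p f \<le> cube_Lp_norm n p g"
proof (cases "p = \<infinity>")
  case True
  have "Max ((\<lambda>\<epsilon>. norm (f \<epsilon>)) ` hypercube n) \<le> Max ((\<lambda>\<epsilon>. norm (g \<epsilon>)) ` hypercube n)"
  proof (intro Max.boundedI)
    fix r assume "r \<in> (\<lambda>\<epsilon>. norm (f \<epsilon>)) ` hypercube n"
    then obtain \<epsilon> where \<epsilon>: "\<epsilon> \<in> hypercube n" "r = norm (f \<epsilon>)" by auto
    then have "r \<le> norm (g \<epsilon>)"
      using assms(2) by simp
    also have "\<dots> \<le> Max ((\<lambda>\<epsilon>. norm (g \<epsilon>)) ` hypercube n)"
      using \<epsilon> by (intro Max_ge) auto
    finally show "r \<le> Max ((\<lambda>\<epsilon>. norm (g \<epsilon>)) ` hypercube n)" .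
  qed auto
  then show ?thesis
    using True by (simp add: cube_Lp_norm_def)
next
  case False
  with assms(1) obtain r where r: "p = ereal r" "1 \<le> r"
    by (cases p) auto
  have "(\<Sum>\<epsilon>\<in>hypercube n. norm (f \<epsilon>) powr r) / 2 ^ n \<le> (\<Sum>\<epsilon>\<in>hypercube n. norm (g \<epsilon>) powr r) / 2 ^ n"
    using assms(2) r by (intro divide_right_mono sum_mono powr_mono2) auto
  then show ?thesis
    using r unfolding cube_Lp_norm_def
    by (auto intro!: powr_mono2 divide_nonneg_nonneg sum_nonneg)
qed

lemma cube_Lp_norm_le:
  fixes f :: "(nat \<Rightarrow> real) \<Rightarrow> 'a::real_normed_vector"
  assumes "1 \<le> p" "0 \<le> u" "\<And>\<epsilon>. \<epsilon> \<in> hypercube n \<Longrightarrow> norm (f \<epsilon>) \<le> u"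
  shows "cube_Lp_norm n p f \<le> u"
proof -
  have "cube_Lp_norm n p f = cube_Lp_norm n p (\<lambda>\<epsilon>. norm (f \<epsilon>))"
    by (simp add: cube_Lp_norm_def)
  also have "\<dots> \<le> cube_Lp_norm n p (\<lambda>_. u)"
    using assms by (intro cube_Lp_norm_mono) auto
  also have "\<dots> = u"
    using assms by (intro cube_Lp_norm_const) auto
  finally show ?thesis .
qed

lemma cube_Lp_norm_ge:
  fixes f :: "(nat \<Rightarrow> real) \<Rightarrow> 'a::real_normed_vector"
  assumes "1 \<le> p" "0 \<le> u" "\<And>\<epsilon>. \<epsilon> \<in> hypercube n \<Longrightarrow> u \<le> norm (f \<epsilon>)"
  shows "u \<le> cube_Lp_norm n p f"
proof -
  have "u = cube_Lp_norm n p (\<lambda>_. u)"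
    using assms by (intro cube_Lp_norm_const[symmetric]) auto
  also have "\<dots> \<le> cube_Lp_norm n p (\<lambda>\<epsilon>. norm (f \<epsilon>))"
    using assms by (intro cube_Lp_norm_mono) auto
  also have "\<dots> = cube_Lp_norm n p f"
    by (simp add: cube_Lp_norm_def)
  finally show ?thesis .
qed

section \<open>The extremal function\<close>

lemma abs_coord_mean_le_1:
  assumes "\<delta> \<in> hypercube n" "\<epsilon> \<in> hypercube n"
  shows "\<bar>coord_mean n \<delta> \<epsilon>\<bar> \<le> 1"
proof -
  have "\<bar>\<Sum>i\<in>{1..n}. \<epsilon> i * \<delta> i\<bar> \<le> (\<Sum>i\<in>{1..n}. \<bar>\<epsilon> i * \<delta> i\<bar>)"
    by (rule sum_abs)
  also have "\<dots> \<le> (\<Sum>i\<in>{1..n}. 1)"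
    using hypercube_coord[OF assms(1)] hypercube_coord[OF assms(2)] by (intro sum_mono) force
  finally show ?thesis
    unfolding coord_mean_def by (cases "n = 0") (auto simp: divide_simps)
qed

lemma coord_mean_self:
  assumes "\<epsilon> \<in> hypercube n" "0 < n"
  shows "coord_mean n \<epsilon> \<epsilon> = 1"
proof -
  have "(\<Sum>i\<in>{1..n}. \<epsilon> i * \<epsilon> i) = (\<Sum>i\<in>{1..n}. 1)"
    using hypercube_coord[OF assms(1)] by (intro sum.cong) force+
  then show ?thesis
    using assms(2) unfolding coord_mean_def by simp
qed

lemma coord_mean_flip:
  assumes \<epsilon>: "\<epsilon> \<in> hypercube n" and i: "i \<in> {1..n}"
  shows "coord_mean n \<epsilon> (\<epsilon>(i := - \<epsilon> i)) = 1 - 2 / n"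
proof -
  have "(\<Sum>j\<in>{1..n}. (\<epsilon>(i := - \<epsilon> i)) j * \<epsilon> j) = (\<Sum>j\<in>{1..n}. 1 - (if j = i then 2 else 0))"
    using hypercube_coord[OF \<epsilon>] by (intro sum.cong) force+
  also have "\<dots> = real n - 2"
    using i by (simp add: sum_subtractf)
  finally show ?thesis
    using i unfolding coord_mean_def by (simp add: diff_divide_distrib)
qed

text \<open>
  The vectors are enumerated by the points of the cube through \<open>g\<close>. Given \<open>\<epsilon>\<close>, the coefficient at the
  index \<open>k\<close> with \<open>g k = \<epsilon>\<close> is the Laplacian at \<open>\<epsilon>\<close> of a Chebyshev polynomial that peaks there.
\<close>

lemma chebyshev_function_on_cube:
  fixes x :: "nat \<Rightarrow> 'a::real_normed_vector"
  assumes n: "0 < n" and p: "1 \<le> p" and \<tau>: "0 < \<tau>" "3 * \<tau> \<le> 1"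
    and x: "\<And>i. i \<in> {1..2 ^ n} \<Longrightarrow> 1 - \<tau> \<le> norm (x i)"
    and sgn: "\<And>\<epsilon>. \<epsilon> \<in> hypercube (2 ^ n) \<Longrightarrow> norm (\<Sum>i\<in>{1..2 ^ n}. \<epsilon> i *\<^sub>R x i) \<le> 1 + \<tau>"
  obtains f :: "(nat \<Rightarrow> real) \<Rightarrow> 'a" where "cube_degree_le n f d"
    and "cube_Lp_norm n p f \<le> 1 + \<tau>"
    and "(1 - 3 * \<tau>) * (real n / 2 * (1 - chebyshev d (1 - 2 / n))) \<le> cube_Lp_norm n p (cube_laplacian n f)"
proof -
  define N :: nat where "N = 2 ^ n"
  have x: "\<And>i. i \<in> {1..N} \<Longrightarrow> 1 - \<tau> \<le> norm (x i)"
    and sgn: "\<And>\<epsilon>. \<epsilon> \<in> hypercube N \<Longrightarrow> norm (\<Sum>i\<in>{1..N}. \<epsilon> i *\<^sub>R x i) \<le> 1 + \<tau>"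
    using x sgn unfolding N_def by auto
  obtain g where g: "bij_betw g {1..N} (hypercube n)"
    using finite_same_card_bij[of "{1..N}" "hypercube n"] card_hypercube[of n] unfolding N_def by auto
  define T where "T j \<epsilon> = chebyshev d (coord_mean n (g j) \<epsilon>)" for j \<epsilon>
  define f where "f \<epsilon> = (\<Sum>j\<in>{1..N}. T j \<epsilon> *\<^sub>R x j)" for \<epsilon>
  define D where "D = real n / 2 * (1 - chebyshev d (1 - 2 / n))"
  have "cube_degree_le n f d"
    unfolding f_def T_def by (intro cube_degree_le_sum cube_degree_le_chebyshev)
  moreover have "cube_Lp_norm n p f \<le> 1 + \<tau>"
  proof (rule cube_Lp_norm_le[OF p])
    fix \<epsilon> assume \<epsilon>: "\<epsilon> \<in> hypercube n"
    have "norm (\<Sum>j\<in>{1..N}. T j \<epsilon> *\<^sub>R x j) \<le> 1 * (1 + \<tau>)"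
    proof (rule norm_sum_le_of_hypercube[OF sgn])
      fix j assume "j \<in> {1..N}"
      then have "g j \<in> hypercube n"
        using g bij_betwE by blast
      then show "\<bar>T j \<epsilon>\<bar> \<le> 1"
        unfolding T_def using \<epsilon> by (intro abs_chebyshev_le_1 abs_coord_mean_le_1)
    qed auto
    then show "norm (f \<epsilon>) \<le> 1 + \<tau>"
      unfolding f_def by simp
  qed (use \<tau> in simp)
  moreover have "(1 - 3 * \<tau>) * D \<le> cube_Lp_norm n p (cube_laplacian n f)"
  proof -
    have "\<bar>1 - 2 / real n\<bar> \<le> 1"
      using n by (auto simp: abs_le_iff field_simps)
    then have D0: "0 \<le> D"
      unfolding D_def using abs_chebyshev_le_1[of "1 - 2 / real n" d] by simp
    show ?thesis
    proof (rule cube_Lp_norm_ge[OF p])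
      show "0 \<le> (1 - 3 * \<tau>) * D"
        using D0 \<tau> by simp
    next
      fix \<epsilon> assume \<epsilon>: "\<epsilon> \<in> hypercube n"
      define b where "b j = (\<Sum>i\<in>{1..n}. (T j \<epsilon> - T j (\<epsilon>(i := - \<epsilon> i))) / 2)" for j
      have "cube_laplacian n f \<epsilon> =
          (\<Sum>i\<in>{1..n}. \<Sum>j\<in>{1..N}. ((T j \<epsilon> - T j (\<epsilon>(i := - \<epsilon> i))) / 2) *\<^sub>R x j)"
        unfolding cube_laplacian_eq_sum_differences[OF \<epsilon>] f_def sum_subtractf[symmetric]
          scaleR_right.sum scaleR_diff_left[symmetric] by simp
      also have "\<dots> = (\<Sum>j\<in>{1..N}. b j *\<^sub>R x j)"
        unfolding b_def by (subst sum.swap) (simp add: scaleR_left.sum)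
      finally have lap: "cube_laplacian n f \<epsilon> = (\<Sum>j\<in>{1..N}. b j *\<^sub>R x j)" .
      obtain k where k: "k \<in> {1..N}" "g k = \<epsilon>"
        using g \<epsilon> unfolding bij_betw_def by (metis imageE)
      have "b k = (\<Sum>i\<in>{1..n}. (1 - chebyshev d (1 - 2 / n)) / 2)"
        unfolding b_def T_def k(2) using \<epsilon> n
        by (intro sum.cong refl) (simp add: coord_mean_self coord_mean_flip chebyshev_at_1)
      then have "b k = D"
        unfolding D_def by simp
      moreover have "\<bar>b k\<bar> * (2 * (1 - \<tau>) - (1 + \<tau>)) \<le> norm (\<Sum>j\<in>{1..N}. b j *\<^sub>R x j)"
        using \<tau> by (intro norm_sum_ge_of_hypercube[OF sgn x _ k(1)]) auto
      ultimately show "(1 - 3 * \<tau>) * D \<le> norm (cube_laplacian n f \<epsilon>)"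
        using D0 unfolding lap by (simp add: mult.commute)
    qed
  qed
  ultimately show thesis
    using that unfolding D_def by blast
qed

theorem theorem5:
  fixes p :: ereal
  assumes "1 \<le> p"
    and "\<exists>\<eta> d. 0 < \<eta> \<and> \<eta> < 1 \<and> 1 \<le> d \<and>
           (\<forall>n\<ge>d. \<forall>f :: (nat \<Rightarrow> real) \<Rightarrow> 'a::complex_banach.
              cube_degree_le n f d \<longrightarrow>
              cube_Lp_norm n p (cube_laplacian n f)
                \<le> (1 - \<eta>) * (real d)\<^sup>2 * cube_Lp_norm n p f)"
  shows "finite_cotype TYPE('a)"
proof (rule ccontr)
  assume no_cotype: "\<not> finite_cotype TYPE('a)"
  obtain \<eta> d where \<eta>: "0 < \<eta>" "\<eta> < 1" and d: "1 \<le> d"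
    and bern: "\<And>n f :: (nat \<Rightarrow> real) \<Rightarrow> 'a. d \<le> n \<Longrightarrow> cube_degree_le n f d \<Longrightarrow>
        cube_Lp_norm n p (cube_laplacian n f) \<le> (1 - \<eta>) * (real d)\<^sup>2 * cube_Lp_norm n p f"
    using assms(2) by blast
  \<comment> \<open>The choice of \<open>\<tau>\<close> makes \<open>(1 - 3 * \<tau>) * (1 - \<eta> / 2)\<close> exceed \<open>(1 - \<eta>) * (1 + \<tau>)\<close>.\<close>
  define \<tau> where "\<tau> = \<eta> / 16"
  define D where "D n = real n / 2 * (1 - chebyshev d (1 - 2 / real n))" for n
  have \<tau>: "0 < \<tau>" "3 * \<tau> \<le> 1" "\<tau> \<le> 1"
    unfolding \<tau>_def using \<eta> by auto
  have d2: "0 < (real d)\<^sup>2"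
    using d by simp
  have "(1 - \<eta> / 2) * (real d)\<^sup>2 < (real d)\<^sup>2"
    using \<eta> d2 by (simp add: algebra_simps)
  then have "\<forall>\<^sub>F n in sequentially. (1 - \<eta> / 2) * (real d)\<^sup>2 < D n"
    using order_tendstoD(1)[OF chebyshev_laplacian_limit[of d]] unfolding D_def by blast
  then have "\<forall>\<^sub>F n in sequentially. (1 - \<eta> / 2) * (real d)\<^sup>2 < D n \<and> d \<le> n"
    using eventually_ge_at_top[of d] by (rule eventually_conj)
  then obtain n where n: "(1 - \<eta> / 2) * (real d)\<^sup>2 < D n" "d \<le> n"
    by (auto simp: eventually_sequentially)
  have n0: "0 < n"
    using n d by simp
  then have "2 \<le> (2::nat) ^ n"
    by (cases n) auto
  then obtain x :: "nat \<Rightarrow> 'a" where x: "\<And>i. i \<in> {1..2 ^ n} \<Longrightarrow> 1 - \<tau> \<le> norm (x i)"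
    "\<And>\<epsilon>. \<epsilon> \<in> hypercube (2 ^ n) \<Longrightarrow> norm (\<Sum>i\<in>{1..2 ^ n}. \<epsilon> i *\<^sub>R x i) \<le> 1 + \<tau>"
    using almost_isometric_sup_norm_vectors[OF no_cotype _ \<tau>(1,3)] by metis
  obtain f :: "(nat \<Rightarrow> real) \<Rightarrow> 'a" where f: "cube_degree_le n f d"
    "cube_Lp_norm n p f \<le> 1 + \<tau>" "(1 - 3 * \<tau>) * D n \<le> cube_Lp_norm n p (cube_laplacian n f)"
    using chebyshev_function_on_cube[OF n0 assms(1) \<tau>(1,2) x, of d] unfolding D_def by blast
  have "(1 - 3 * \<tau>) * ((1 - \<eta> / 2) * (real d)\<^sup>2) < (1 - 3 * \<tau>) * D n"
    using n(1) \<eta> unfolding \<tau>_def by (intro mult_strict_left_mono) auto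
  also have "\<dots> \<le> (1 - \<eta>) * (real d)\<^sup>2 * cube_Lp_norm n p f"
    using f(3) bern[OF n(2) f(1)] by linarith
  also have "\<dots> \<le> (1 - \<eta>) * (real d)\<^sup>2 * (1 + \<tau>)"
    using f(2) \<eta> by (intro mult_left_mono) auto
  finally have "((1 - 3 * \<tau>) * (1 - \<eta> / 2)) * (real d)\<^sup>2 < ((1 - \<eta>) * (1 + \<tau>)) * (real d)\<^sup>2"
    by (simp only: mult_ac)
  then have "(1 - 3 * \<tau>) * (1 - \<eta> / 2) < (1 - \<eta>) * (1 + \<tau>)"
    using d2 by (simp only: mult_less_cancel_right_pos)
  then have "\<eta> / 4 + 5 * (\<eta> * \<eta>) / 32 < 0"
    unfolding \<tau>_def by (simp add: field_simps)
  moreover have "0 < \<eta> * \<eta>"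
    using \<eta> by simp
  ultimately show False
    using \<eta> by linarith
qed

end
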